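(* Let $I\subset\mathbb{R}$ be an open interval and fix $s_0\in I$. Let $\theta,\mu:I\to\mathbb{R}$ be two smooth functions such that $s_0$ is the only zero of $\theta$. For each choice of sign $\epsilon\in\{+1,-1\}$ there exists a unit speed spacelike curve $\gamma:I\to\mathbb{L}^3$ with non-zero curvature vector such that (a) the causal curvature function and the pseudo-torsion function of $\gamma$ coincide on $I$ with $\theta$ and $\mu$, respectively; and (b) the sign $\mathrm{sgn}(\gamma,s_0)$ coincides with $\epsilon$. Moreover, such a curve is unique up to orientation preserving isometries of $\mathbb{L}^3$; that is, if $\gamma_1,\gamma_2$ are two unit speed spacelike curves on $I$ with non-zero curvature vector satisfying (a) and (b) for the same $\theta,\mu,\epsilon$, then $\gamma_2=T\circ\gamma_1$ for some orientation preserving isometry $T$ of $\mathbb{L}^3$.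
   Context: $\mathbb{L}^3$ is $\mathbb{R}^3$ with the inner product $\langle \boldsymbol{x},\boldsymbol{x}\rangle=x^2+y^2-z^2$ for $\boldsymbol{x}=(x,y,z)^T$. A vector $\boldsymbol{x}$ is spacelike if $\langle\boldsymbol{x},\boldsymbol{x}\rangle>0$ or $\boldsymbol{x}=\boldsymbol{0}$, timelike if $\langle\boldsymbol{x},\boldsymbol{x}\rangle<0$, and lightlike if $\boldsymbol{x}\neq\boldsymbol{0}$ and $\langle\boldsymbol{x},\boldsymbol{x}\rangle=0$. The vector product is $\boldsymbol{v}\times\boldsymbol{w}:=Z(\boldsymbol{v}\times_{\mathrm e}\boldsymbol{w})$, where $Z=\mathrm{diag}(1,1,-1)$ and $\times_{\mathrm e}$ is the standard Euclidean cross product. The isometry group of $\mathbb{L}^3$ is $\mathrm{O}(2,1)\ltimes\mathbb{L}^3$, where $\mathrm{O}(2,1)=\{A: A^TZA=Z\}$; an isometry is orientation preserving if its linear part has determinant $1$. All curves are smooth. A regular curve is spacelike if each of its tangent vectors is spacelike. For a unit speed spacelike curve $\gamma:I\to\mathbb{L}^3$ ($\langle\gamma',\gamma'\rangle=1$), set $\boldsymbol{e}:=\gamma'$, $\boldsymbol{\kappa}:=\gamma''$ (curvature vector field), and $\theta:=\langle\boldsymbol{\kappa},\boldsymbol{\kappa}\rangle$ (causal curvature function). The curve has non-zero curvature vector if $\boldsymbol{\kappa}$ vanishes nowhere. A point $s_0$ is curvature-lightlike if $\boldsymbol{\kappa}(s_0)$ is lightlike; then $\boldsymbol{e}(s_0)\times\boldsymbol{\kappa}(s_0)=\epsilon\,\boldsymbol{\kappa}(s_0)$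 for some $\epsilon\in\{+1,-1\}$, called the sign and denoted $\mathrm{sgn}(\gamma,s_0)$. Let $s_0$ be a curvature-lightlike point, $\epsilon=\mathrm{sgn}(\gamma,s_0)$, and assume $s_0$ is the only curvature-lightlike point in an open interval $J\ni s_0$ (here $J=I$). The pseudo-binormal vector field $\boldsymbol{\beta}$ on $J$ is the (unique, smooth) vector field along $\gamma$ satisfying $\boldsymbol{e}\times\boldsymbol{\kappa}=\epsilon(\boldsymbol{\kappa}-\theta\boldsymbol{\beta})$; that is, $\boldsymbol{\beta}=\frac1\theta(\boldsymbol{\kappa}-\epsilon\,\boldsymbol{e}\times\boldsymbol{\kappa})$ on $J\setminus\{s_0\}$, extended smoothly to $s_0$. The pseudo-torsion function is $\mu:=-\langle\boldsymbol{\kappa}',\boldsymbol{\beta}\rangle$. *)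

theory Defs
  imports "HOL-Analysis.Analysis"
begin

section \<open>Lorentz--Minkowski 3-space\<close>

definition Zmat :: "real^3^3" where
  "Zmat = vector [vector [1, 0, 0], vector [0, 1, 0], vector [0, 0, -1]]"

definition lorentz :: "real^3 \<Rightarrow> real^3 \<Rightarrow> real" where
  "lorentz v w = v $ 1 * w $ 1 + v $ 2 * w $ 2 - v $ 3 * w $ 3"

definition spacelike :: "real^3 \<Rightarrow> bool" where
  "spacelike v \<longleftrightarrow> lorentz v v > 0 \<or> v = 0"

definition lorentz_cross :: "real^3 \<Rightarrow> real^3 \<Rightarrow> real^3" where
  "lorentz_cross v w = Zmat *v cross3 v w"

definition O21 :: "(real^3^3) set" where
  "O21 = {A. transpose A ** Zmat ** A = Zmat}"

definition orientation_preserving_isometry :: "(real^3 \<Rightarrow> real^3) \<Rightarrow> bool" where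
  "orientation_preserving_isometry T \<longleftrightarrow>
     (\<exists>A\<in>O21. \<exists>b. det A = 1 \<and> (\<forall>x. T x = A *v x + b))"


section \<open>Smooth maps and curves\<close>

abbreviation vderiv :: "(real \<Rightarrow> 'a::real_normed_vector) \<Rightarrow> real \<Rightarrow> 'a" where
  "vderiv f \<equiv> (\<lambda>t. vector_derivative f (at t))"

text \<open>
  To be used for open \<open>S\<close> only: derivatives are taken in the full neighbourhood filter, so all
  iterated derivatives at points of \<open>S\<close> depend only on the restriction of \<open>f\<close> to \<open>S\<close>.
\<close>
definition smooth_on :: "real set \<Rightarrow> (real \<Rightarrow> 'a::real_normed_vector) \<Rightarrow> bool" where
  "smooth_on S f \<longleftrightarrow> (\<forall>n. \<forall>t\<in>S. (vderiv ^^ n) f differentiable (at t))"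

definition unit_speed_spacelike_curve :: "real set \<Rightarrow> (real \<Rightarrow> real^3) \<Rightarrow> bool" where
  "unit_speed_spacelike_curve I \<gamma> \<longleftrightarrow>
     smooth_on I \<gamma> \<and>
     (\<forall>s\<in>I. vderiv \<gamma> s \<noteq> 0 \<and> spacelike (vderiv \<gamma> s)) \<and>
     (\<forall>s\<in>I. lorentz (vderiv \<gamma> s) (vderiv \<gamma> s) = 1)"

definition curvature_vector :: "(real \<Rightarrow> real^3) \<Rightarrow> real \<Rightarrow> real^3" where
  "curvature_vector \<gamma> = vderiv (vderiv \<gamma>)"

definition nonzero_curvature_vector :: "real set \<Rightarrow> (real \<Rightarrow> real^3) \<Rightarrow> bool" where
  "nonzero_curvature_vector I \<gamma> \<longleftrightarrow> (\<forall>s\<in>I. curvature_vector \<gamma> s \<noteq> 0)"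

definition causal_curvature :: "(real \<Rightarrow> real^3) \<Rightarrow> real \<Rightarrow> real" where
  "causal_curvature \<gamma> s = lorentz (curvature_vector \<gamma> s) (curvature_vector \<gamma> s)"

text \<open>Meaningful when \<open>s0\<close> is a curvature-lightlike point of a unit speed spacelike curve.\<close>
definition curve_sign :: "(real \<Rightarrow> real^3) \<Rightarrow> real \<Rightarrow> real" where
  "curve_sign \<gamma> s0 = (THE \<epsilon>. \<epsilon> \<in> {1, -1} \<and>
     lorentz_cross (vderiv \<gamma> s0) (curvature_vector \<gamma> s0) = \<epsilon> *\<^sub>R curvature_vector \<gamma> s0)"

definition is_pseudo_binormal ::
  "real set \<Rightarrow> (real \<Rightarrow> real^3) \<Rightarrow> real \<Rightarrow> (real \<Rightarrow> real^3) \<Rightarrow> bool" where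
  "is_pseudo_binormal J \<gamma> s0 \<beta> \<longleftrightarrow> smooth_on J \<beta> \<and>
     (\<forall>s\<in>J. lorentz_cross (vderiv \<gamma> s) (curvature_vector \<gamma> s) =
        curve_sign \<gamma> s0 *\<^sub>R (curvature_vector \<gamma> s - causal_curvature \<gamma> s *\<^sub>R \<beta> s))"

text \<open>
  The field is determined on \<open>J\<close> only (see \<open>is_pseudo_binormal_unique\<close> below), so the choice
  only concerns irrelevant values outside \<open>J\<close>.
\<close>
definition pseudo_binormal :: "real set \<Rightarrow> (real \<Rightarrow> real^3) \<Rightarrow> real \<Rightarrow> real \<Rightarrow> real^3" where
  "pseudo_binormal J \<gamma> s0 = (SOME \<beta>. is_pseudo_binormal J \<gamma> s0 \<beta>)"

definition pseudo_torsion :: "real set \<Rightarrow> (real \<Rightarrow> real^3) \<Rightarrow> real \<Rightarrow> real \<Rightarrow> real" where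
  "pseudo_torsion J \<gamma> s0 s =
     - lorentz (vderiv (curvature_vector \<gamma>) s) (pseudo_binormal J \<gamma> s0 s)"

lemma is_pseudo_binormal_unique:
  assumes "open J" "s0 \<in> J"
    and only: "\<And>s. s \<in> J \<Longrightarrow> causal_curvature \<gamma> s = 0 \<Longrightarrow> s = s0"
    and sgn: "curve_sign \<gamma> s0 \<noteq> 0"
    and 1: "is_pseudo_binormal J \<gamma> s0 \<beta>1" and 2: "is_pseudo_binormal J \<gamma> s0 \<beta>2"
    and "s \<in> J"
  shows "\<beta>1 s = \<beta>2 s"
proof -
  have off: "\<beta>1 t = \<beta>2 t" if "t \<in> J" "t \<noteq> s0" for t
  proof -
    let ?eq = "\<lambda>\<beta>. lorentz_cross (vderiv \<gamma> t) (curvature_vector \<gamma> t) =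
      curve_sign \<gamma> s0 *\<^sub>R (curvature_vector \<gamma> t - causal_curvature \<gamma> t *\<^sub>R \<beta> t)"
    have eq: "?eq \<beta>" if "is_pseudo_binormal J \<gamma> s0 \<beta>" for \<beta>
      using that \<open>t \<in> J\<close> unfolding is_pseudo_binormal_def by (elim conjE bspec)
    have "causal_curvature \<gamma> t \<noteq> 0"
      using only \<open>t \<in> J\<close> \<open>t \<noteq> s0\<close> by blast
    then show ?thesis
      using trans[OF sym[OF eq[OF 1]] eq[OF 2]] sgn by simp
  qed
  have cont: "isCont \<beta> s0" if "is_pseudo_binormal J \<gamma> s0 \<beta>" for \<beta>
  proof -
    have "(vderiv ^^ 0) \<beta> differentiable (at s0)"
      using that \<open>s0 \<in> J\<close> by (auto simp only: is_pseudo_binormal_def smooth_on_def)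
    then show ?thesis
      by (simp add: differentiable_imp_continuous_within)
  qed
  have "\<forall>\<^sub>F t in at s0. t \<in> J - {s0}"
    unfolding eventually_at_topological using assms(1,2) by blast
  then have "\<forall>\<^sub>F t in at s0. \<beta>1 t = \<beta>2 t"
    by (rule eventually_mono) (simp add: off)
  then have "\<beta>1 \<midarrow>s0\<rightarrow> \<beta>2 s0"
    using cont[OF 2] unfolding isCont_def by (rule tendsto_cong[THEN iffD2])
  then have "\<beta>1 s0 = \<beta>2 s0"
    using cont[OF 1] unfolding isCont_def by (rule LIM_unique[rotated])
  then show ?thesis
    using off[OF \<open>s \<in> J\<close>] by (cases "s = s0") simp_all
qed

end

theory Submission
  imports Defs
begin

text \<open>
  A curve with the prescribed data carries the moving frame formed by its tangent vector \<open>e\<close>, its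
  curvature vector \<open>\<kappa>\<close> and its pseudo-binormal \<open>\<beta>\<close>. The inner products of these vectors are \<open>1\<close> for
  \<open>\<langle>e, e\<rangle>\<close> and \<open>\<langle>\<kappa>, \<beta>\<rangle>\<close>, \<open>\<theta>\<close> for \<open>\<langle>\<kappa>, \<kappa>\<rangle>\<close>, and \<open>0\<close> otherwise, and
  the determinant of the frame is the sign \<open>\<epsilon>\<close>. Differentiating these relations,
  and using \<open>\<langle>\<kappa>', \<beta>\<rangle> = - \<mu>\<close>, gives the linear system

  \<open>e' = \<kappa>\<close>, \<open>\<kappa>' = - \<theta> e - \<mu> \<kappa> + (\<theta>'/2 + \<theta> \<mu>) \<beta>\<close>, \<open>\<beta>' = - e + \<mu> \<beta>\<close>,

  whose coefficients depend only on \<open>\<theta>\<close> and \<open>\<mu>\<close> and are smooth on all of \<open>I\<close>, also at \<open>s0\<close>. The theorem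
  is thus a statement on a linear differential equation, as in the classical theorem on Frenet frames.

  The point that is particular to the lightlike case is that this frame is available at \<open>s0\<close>
  (\<open>realized_curve_has_frame\<close>). The quotient of \<open>\<kappa> - \<epsilon> (e \<times> \<kappa>)\<close> by \<open>\<theta>\<close> is of no use there, as
  \<open>\<theta>\<close> may vanish to infinite order. Instead, \<open>\<beta>\<close> is located geometrically. It lies on the null line
  of the plane orthogonal to \<open>e\<close> on which \<open>v \<mapsto> e \<times> v\<close> is multiplication by \<open>- \<epsilon>\<close>. This line has
  a smooth generator \<open>n\<close>, and \<open>\<langle>\<kappa>, n\<rangle>\<close> vanishes nowhere, so that \<open>\<beta> = n / \<langle>\<kappa>, n\<rangle>\<close>
  (\<open>null_normal_decomposition\<close>, \<open>null_normal_transversal\<close>).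

  For existence, the system is solved on \<open>I\<close> by a Picard series (\<open>linear_ode_solution_exists\<close>), starting
  from a frame with the right inner products and determinant at \<open>s0\<close>. The Gram matrix of the frame satisfies a
  linear equation as well, and its prescribed value satisfies the same equation, so the inner products
  are right everywhere (\<open>frame_ode_preserves_gram\<close>). Integrating \<open>e\<close> gives the curve, and
  the orientation of the frame identifies its third vector as the pseudo-binormal
  (\<open>pseudo_frame_realizes\<close>).

  For uniqueness, two frames for the same data are related at \<open>s0\<close> by a linear map, which preserves the
  form and the orientation, and by uniqueness for the linear system the same map relates them everywhere
  (\<open>pseudo_frames_congruent\<close>).
\<close>

section \<open>Closure properties of smooth maps\<close>

text \<open>
  Peeling off the first derivative, not the last one, makes the derivative formulas for sums,
  products and reciprocals directly usable in an induction on the order.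
\<close>
primrec differentiable_times :: "nat \<Rightarrow> real set \<Rightarrow> (real \<Rightarrow> 'a::real_normed_vector) \<Rightarrow> bool" where
  "differentiable_times 0 S f \<longleftrightarrow> True"
| "differentiable_times (Suc k) S f \<longleftrightarrow>
     (\<forall>t\<in>S. f differentiable (at t)) \<and> differentiable_times k S (vderiv f)"

lemma differentiable_times_iff:
  "differentiable_times k S f \<longleftrightarrow> (\<forall>n<k. \<forall>t\<in>S. (vderiv ^^ n) f differentiable (at t))"
proof (induction k arbitrary: f)
  case (Suc k)
  show ?case
    unfolding differentiable_times.simps Suc All_less_Suc2
    by (simp add: funpow_Suc_right del: funpow.simps(2))
qed simp

lemma smooth_on_iff: "smooth_on S f \<longleftrightarrow> (\<forall>k. differentiable_times k S f)"
  unfolding smooth_on_def differentiable_times_iff by blast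

text \<open>
  Derivative formulas hold only at the points of \<open>S\<close>, so \<^term>\<open>vderiv f\<close> is known only there. As
  \<open>S\<close> is open, the values on \<open>S\<close> nevertheless determine all higher derivatives on \<open>S\<close>.
\<close>
lemma differentiable_times_cong:
  assumes "open S" "\<And>t. t \<in> S \<Longrightarrow> f t = g t" "differentiable_times k S f"
  shows "differentiable_times k S g"
  using assms(2,3)
proof (induction k arbitrary: f g)
  case (Suc k)
  have der: "(g has_vector_derivative vderiv f t) (at t)" if "t \<in> S" for t
    using Suc.prems that \<open>open S\<close>
    by (auto intro: has_vector_derivative_transform_within_open simp: vector_derivative_works)
  have "differentiable_times k S (vderiv g)"
    by (rule Suc.IH[of "vderiv f"]) (use der Suc.prems in \<open>auto simp: vector_derivative_at[symmetric]\<close>)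
  then show ?case
    using der by (auto intro: differentiableI_vector)
qed simp

lemma differentiable_times_SucI:
  assumes "open S" "\<And>t. t \<in> S \<Longrightarrow> (f has_vector_derivative f' t) (at t)"
    and "differentiable_times k S f'"
  shows "differentiable_times (Suc k) S f"
  using assms differentiable_times_cong[OF assms(1) _ assms(3), of "vderiv f"]
  by (auto intro: differentiableI_vector simp: vector_derivative_at[symmetric])

lemma differentiable_times_SucD:
  assumes "differentiable_times (Suc k) S f"
  shows "t \<in> S \<Longrightarrow> (f has_vector_derivative vderiv f t) (at t)"
    and "differentiable_times k S (vderiv f)"
    and "differentiable_times k S f"
proof -
  show "differentiable_times k S f"
    using assms unfolding differentiable_times_iff by simp
qed (use assms in \<open>simp_all add: vector_derivative_works\<close>)

lemma differentiable_times_const: "differentiable_times k S (\<lambda>t. c)"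
  by (induction k arbitrary: c) auto

lemma differentiable_times_add:
  assumes "open S" "differentiable_times k S f" "differentiable_times k S g"
  shows "differentiable_times k S (\<lambda>t. f t + g t)"
  using assms(2,3)
proof (induction k arbitrary: f g)
  case (Suc k)
  note f = differentiable_times_SucD[OF Suc.prems(1)] and g = differentiable_times_SucD[OF Suc.prems(2)]
  show ?case
    by (rule differentiable_times_SucI[OF \<open>open S\<close> has_vector_derivative_add[OF f(1) g(1)]])
       (auto intro!: Suc.IH f g)
qed simp

text \<open>
  By Leibniz' rule the derivative is a sum of two products of maps that are differentiable one
  time less.
\<close>
lemma differentiable_times_bilinear:
  assumes "bounded_bilinear h" "open S" "differentiable_times k S f" "differentiable_times k S g"
  shows "differentiable_times k S (\<lambda>t. h (f t) (g t))"
  using assms(3,4)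
proof (induction k arbitrary: f g)
  case (Suc k)
  note f = differentiable_times_SucD[OF Suc.prems(1)] and g = differentiable_times_SucD[OF Suc.prems(2)]
  show ?case
    by (rule differentiable_times_SucI[OF \<open>open S\<close>
          bounded_bilinear.has_vector_derivative[OF assms(1) f(1) g(1)]])
       (auto intro!: differentiable_times_add[OF \<open>open S\<close>] Suc.IH intro: f g)
qed simp

lemma smooth_on_const: "smooth_on S (\<lambda>t. c)"
  by (simp add: smooth_on_iff differentiable_times_const)

lemma smooth_on_add:
  "open S \<Longrightarrow> smooth_on S f \<Longrightarrow> smooth_on S g \<Longrightarrow> smooth_on S (\<lambda>t. f t + g t)"
  by (simp add: smooth_on_iff differentiable_times_add)

lemma smooth_on_bilinear:
  "bounded_bilinear h \<Longrightarrow> open S \<Longrightarrow> smooth_on S f \<Longrightarrow> smooth_on S g \<Longrightarrow>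
    smooth_on S (\<lambda>t. h (f t) (g t))"
  by (simp add: smooth_on_iff differentiable_times_bilinear)

lemmas smooth_on_scaleR = smooth_on_bilinear[OF bounded_bilinear_scaleR]

lemma smooth_on_diff:
  fixes f :: "real \<Rightarrow> 'a::real_normed_vector"
  assumes "open S" "smooth_on S f" "smooth_on S g"
  shows "smooth_on S (\<lambda>t. f t - g t)"
  using smooth_on_add[OF assms(1,2) smooth_on_scaleR[OF assms(1) smooth_on_const[of S "-1"] assms(3)]]
  by simp

text \<open>
  The derivative \<open>- (1/g) g' (1/g)\<close> contains \<open>1/g\<close> itself but not its derivative, so the induction
  on the order of differentiability closes.
\<close>
lemma smooth_on_inverse:
  fixes g :: "real \<Rightarrow> real"
  assumes "open S" "smooth_on S g" "\<And>t. t \<in> S \<Longrightarrow> g t \<noteq> 0"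
  shows "smooth_on S (\<lambda>t. inverse (g t))"
proof -
  have "differentiable_times k S (\<lambda>t. inverse (g t))" for k
  proof (induction k)
    case (Suc k)
    have g: "differentiable_times (Suc k) S g"
      using assms(2) by (simp add: smooth_on_iff)
    have "((\<lambda>t. inverse (g t)) has_vector_derivative
        (- 1) * (inverse (g t) * vderiv g t * inverse (g t))) (at t)" if "t \<in> S" for t
      using differentiable_times_SucD(1)[OF g that] assms(3)[OF that]
      by (auto intro!: derivative_eq_intros simp flip: has_real_derivative_iff_has_vector_derivative)
    moreover have "differentiable_times k S (\<lambda>t. (- 1) * (inverse (g t) * vderiv g t * inverse (g t)))"
      by (intro differentiable_times_bilinear[OF bounded_bilinear_mult \<open>open S\<close>]
          differentiable_times_const Suc.IH differentiable_times_SucD(2)[OF g])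
    ultimately show ?case
      by (rule differentiable_times_SucI[OF \<open>open S\<close>])
  qed simp
  then show ?thesis
    by (simp add: smooth_on_iff)
qed

lemma smooth_on_has_vector_derivative:
  "smooth_on S f \<Longrightarrow> t \<in> S \<Longrightarrow> (f has_vector_derivative vderiv f t) (at t)"
  using differentiable_times_SucD(1)[of 0] by (metis smooth_on_iff)

lemma smooth_on_vderiv: "smooth_on S f \<Longrightarrow> smooth_on S (vderiv f)"
  unfolding smooth_on_iff using differentiable_times_SucD(2) by blast

lemma smooth_onI_derivative:
  assumes "open S" "\<And>t. t \<in> S \<Longrightarrow> (f has_vector_derivative f' t) (at t)" "smooth_on S f'"
  shows "smooth_on S f"
  unfolding smooth_on_iff
proof
  show "differentiable_times k S f" for k
    using differentiable_times_SucI[OF assms(1,2)] assms(3) differentiable_times_SucD(3)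
    unfolding smooth_on_iff by blast
qed

lemma smooth_on_imp_continuous_on: "smooth_on S f \<Longrightarrow> continuous_on S f"
  by (rule continuous_on_vector_derivative)
     (auto intro: has_vector_derivative_at_within smooth_on_has_vector_derivative)

section \<open>Linear differential equations on an open interval\<close>

text \<open>
  A continuous coefficient need not be bounded on an open interval. All estimates are therefore
  made on a compact subinterval that contains the base point and the point of interest in its
  interior.
\<close>
lemma open_interval_compact_neighbourhood:
  fixes I :: "real set"
  assumes "open I" "is_interval I" "s \<in> I" "t \<in> I"
  obtains a b where "a < s" "s < b" "a < t" "t < b" "{a..b} \<subseteq> I"
proof -
  define c e where "c = min s t" and "e = max s t"
  have "c \<in> I" "e \<in> I"
    using assms by (auto simp: c_def e_def min_def max_def)
  then obtain r r' where r: "0 < r" "ball c r \<subseteq> I" and r': "0 < r'" "ball e r' \<subseteq> I"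
    using \<open>open I\<close> openE by metis
  have "c - r / 2 \<in> ball c r" "e + r' / 2 \<in> ball e r'"
    using r(1) r'(1) by (simp_all add: dist_real_def)
  then have "c - r / 2 \<in> I" "e + r' / 2 \<in> I"
    using r(2) r'(2) by (meson subsetD)+
  then have "{c - r / 2..e + r' / 2} \<subseteq> I"
    using \<open>is_interval I\<close> unfolding is_interval_1 by (meson atLeastAtMost_iff subsetI)
  moreover have "c - r / 2 < s" "s < e + r' / 2" "c - r / 2 < t" "t < e + r' / 2"
    using r(1) r'(1) unfolding c_def e_def by linarith+
  ultimately show ?thesis
    using that by blast
qed

text \<open>
  The interval integral is oriented, so that one formula covers both sides of \<open>s0\<close>.
\<close>
lemma antiderivative_on_open_interval:
  fixes f :: "real \<Rightarrow> 'a::euclidean_space"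
  assumes "open I" "is_interval I" "s0 \<in> I" "continuous_on I f"
  obtains F where "F s0 = c" "\<And>t. t \<in> I \<Longrightarrow> (F has_vector_derivative f t) (at t)"
proof -
  let ?F = "\<lambda>u. c + (LBINT y=s0..u. f y)"
  have "(?F has_vector_derivative f t) (at t)" if t: "t \<in> I" for t
  proof -
    obtain a b where ab: "a < s0" "s0 < b" "a < t" "t < b" "{a..b} \<subseteq> I"
      using open_interval_compact_neighbourhood[OF assms(1-3) t] .
    have "((\<lambda>u. LBINT y=s0..u. f y) has_vector_derivative f t) (at t within {a..b})"
      using ab by (intro interval_integral_FTC2 continuous_on_subset[OF assms(4)]) auto
    then have "((\<lambda>u. LBINT y=s0..u. f y) has_vector_derivative f t) (at t)"
      using ab at_within_Icc_at[of a t b] by simp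
    from has_vector_derivative_add[OF has_vector_derivative_const this, of c] show ?thesis
      by simp
  qed
  then show ?thesis
    by (intro that[of ?F]) auto
qed

text \<open>
  Integrating \<open>n\<close> times from \<open>s0\<close> yields \<open>\<bar>t - s0\<bar>\<^sup>n / n!\<close>. This bound serves existence, where
  \<open>f n\<close> is the increment between consecutive Picard iterates, and uniqueness, where all \<open>f n\<close> are the
  same solution with initial value zero. The integration runs along the segment \<open>s0 + r h\<close> with
  \<open>0 \<le> r \<le> 1\<close>, which treats \<open>t \<ge> s0\<close> and \<open>t \<le> s0\<close> alike.
\<close>
lemma iterated_growth_bound:
  fixes f f' :: "nat \<Rightarrow> real \<Rightarrow> 'a::real_normed_vector"
  assumes s0: "s0 \<in> {a..b}" and K: "0 \<le> K"
    and der: "\<And>n t. t \<in> {a..b} \<Longrightarrow> (f (Suc n) has_vector_derivative f' (Suc n) t) (at t)"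
    and bound: "\<And>n t. t \<in> {a..b} \<Longrightarrow> norm (f' (Suc n) t) \<le> K * norm (f n t)"
    and init: "\<And>n. f (Suc n) s0 = 0"
    and start: "\<And>t. t \<in> {a..b} \<Longrightarrow> norm (f 0 t) \<le> C"
    and t: "t \<in> {a..b}"
  shows "norm (f n t) \<le> C * (K * \<bar>t - s0\<bar>) ^ n / fact n"
  using t
proof (induction n arbitrary: t)
  case 0
  then show ?case
    using start by simp
next
  case (Suc n)
  define h where "h = t - s0"
  let ?\<phi> = "\<lambda>r. C * (K * \<bar>h\<bar>) ^ Suc n * r ^ Suc n / fact (Suc n)"
  let ?\<phi>' = "\<lambda>r. C * (K * \<bar>h\<bar>) ^ Suc n * r ^ n / fact n"
  have ray: "s0 + r * h \<in> {a..b}" if "0 \<le> r" "r \<le> 1" for r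
  proof -
    have "s0 + r * h = (1 - r) * s0 + r * t"
      by (simp add: h_def algebra_simps)
    moreover have "(1 - r) *\<^sub>R s0 + r *\<^sub>R t \<in> {a..b}"
      using that s0 Suc.prems by (intro convexD) (auto simp: convex_closed_interval)
    ultimately show ?thesis
      by simp
  qed
  have der_ray: "((\<lambda>r. f (Suc n) (s0 + r * h)) has_vector_derivative h *\<^sub>R f' (Suc n) (s0 + r * h)) (at r)"
    if "0 \<le> r" "r \<le> 1" for r
  proof -
    have "((\<lambda>r. s0 + r * h) has_vector_derivative h) (at r)"
      by (auto intro!: derivative_eq_intros simp flip: has_real_derivative_iff_has_vector_derivative)
    from vector_diff_chain_at[OF this der[OF ray[OF that]]] show ?thesis
      by (simp add: o_def)
  qed
  have "norm (f (Suc n) (s0 + 1 * h) - f (Suc n) (s0 + 0 * h)) \<le> ?\<phi> 1 - ?\<phi> 0"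
  proof (rule differentiable_bound_general)
    show "continuous_on {0..1} (\<lambda>r. f (Suc n) (s0 + r * h))"
      by (rule continuous_on_vector_derivative) (auto intro: has_vector_derivative_at_within der_ray)
    show "(?\<phi> has_vector_derivative ?\<phi>' r) (at r)" for r
      unfolding has_real_derivative_iff_has_vector_derivative[symmetric]
      by (rule derivative_eq_intros refl | simp add: field_simps del: power_Suc of_nat_Suc)+
    show "norm (h *\<^sub>R f' (Suc n) (s0 + r * h)) \<le> ?\<phi>' r" if "0 < r" "r < 1" for r
    proof -
      have "norm (f n (s0 + r * h)) \<le> C * (K * \<bar>s0 + r * h - s0\<bar>) ^ n / fact n"
        using that by (intro Suc.IH ray) auto
      then have "norm (f' (Suc n) (s0 + r * h)) \<le> K * (C * (K * \<bar>r * h\<bar>) ^ n / fact n)"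
        using bound[OF ray, of r n] that mult_left_mono[OF _ K] by force
      then have "\<bar>h\<bar> * norm (f' (Suc n) (s0 + r * h)) \<le> \<bar>h\<bar> * (K * (C * (K * \<bar>r * h\<bar>) ^ n / fact n))"
        by (rule mult_left_mono) simp
      also have "\<dots> = ?\<phi>' r"
        using that by (simp add: abs_mult power_mult_distrib)
      finally show ?thesis
        by simp
    qed
  qed (auto intro!: continuous_intros der_ray)
  then show ?case
    using init by (simp add: h_def)
qed

lemma power_over_fact_summable: "summable (\<lambda>n. C * K ^ n / fact n :: real)"
  using summable_mult[OF summable_exp[of K], of C] by (simp add: field_simps)

text \<open>
  Such a \<open>Y\<close> may play the role of every member of the sequence in
  \<open>iterated_growth_bound\<close>, so its norm lies below the terms of a convergent series.
\<close>
lemma linear_ode_zero_unique: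
  fixes Y :: "real \<Rightarrow> 'a::real_normed_vector"
  assumes I: "open I" "is_interval I" "s0 \<in> I" and "Y s0 = 0"
    and der: "\<And>t. t \<in> I \<Longrightarrow> (Y has_vector_derivative Y' t) (at t)"
    and bound: "\<And>a b. {a..b} \<subseteq> I \<Longrightarrow> \<exists>K. \<forall>t\<in>{a..b}. norm (Y' t) \<le> K * norm (Y t)"
    and t: "t \<in> I"
  shows "Y t = 0"
proof -
  obtain a b where ab: "a < s0" "s0 < b" "a < t" "t < b" "{a..b} \<subseteq> I"
    using open_interval_compact_neighbourhood[OF I t] .
  obtain K where K: "\<And>u. u \<in> {a..b} \<Longrightarrow> norm (Y' u) \<le> K * norm (Y u)"
    using bound[OF ab(5)] by blast
  have K': "norm (Y' u) \<le> max 0 K * norm (Y u)" if "u \<in> {a..b}" for u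
    by (rule order_trans[OF K[OF that]]) (simp add: mult_right_mono)
  have "continuous_on I Y"
    by (rule continuous_on_vector_derivative) (rule has_vector_derivative_at_within[OF der])
  then have "continuous_on {a..b} Y"
    using ab(5) by (rule continuous_on_subset)
  then have "bounded (Y ` {a..b})"
    by (intro compact_imp_bounded compact_continuous_image) auto
  then obtain C where C: "\<And>u. u \<in> {a..b} \<Longrightarrow> norm (Y u) \<le> C"
    unfolding bounded_iff by blast
  have "norm (Y t) \<le> C * (max 0 K * \<bar>t - s0\<bar>) ^ n / fact n" for n
    using ab \<open>Y s0 = 0\<close>
    by (intro iterated_growth_bound[where f="\<lambda>n. Y" and f'="\<lambda>n. Y'" and a=a and b=b] der K' C) auto
  then have "norm (Y t) \<le> 0"
    by (intro LIMSEQ_le_const[OF summable_LIMSEQ_zero[OF power_over_fact_summable]]) auto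
  then show ?thesis
    by simp
qed

lemma bounded_bilinear_compact_bound:
  assumes "bounded_bilinear h" "compact S" "continuous_on S A"
  obtains K where "0 \<le> K" "\<And>t x. t \<in> S \<Longrightarrow> norm (h (A t) x) \<le> K * norm x"
proof -
  obtain M where M: "\<And>t. t \<in> S \<Longrightarrow> norm (A t) \<le> M"
    using compact_imp_bounded[OF compact_continuous_image[OF assms(3,2)]] by (auto simp: bounded_iff)
  obtain B where B: "0 < B" "\<And>x y. norm (h x y) \<le> norm x * norm y * B"
    using bounded_bilinear.pos_bounded[OF assms(1)] by blast
  have "norm (h (A t) x) \<le> max 0 (M * B) * norm x" if "t \<in> S" for t x
  proof -
    have "norm (h (A t) x) \<le> norm (A t) * norm x * B"
      by (rule B)
    also have "\<dots> \<le> M * norm x * B"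
      using M[OF that] B(1) by (intro mult_right_mono) auto
    also have "\<dots> = M * B * norm x"
      by simp
    also have "\<dots> \<le> max 0 (M * B) * norm x"
      by (intro mult_right_mono) auto
    finally show ?thesis .
  qed
  then show ?thesis
    by (intro that[of "max 0 (M * B)"]) auto
qed

text \<open>
  The solution is the sum of the Picard increments. The factorials make this series converge
  uniformly on every compact subinterval, however large the coefficient is, so the solution exists on
  all of \<open>I\<close>. The right-hand side is an arbitrary bounded bilinear map, so that the matrix product is an
  instance.
\<close>
lemma linear_ode_solution_exists:
  fixes h :: "'a::real_normed_vector \<Rightarrow> 'b::euclidean_space \<Rightarrow> 'b"
  assumes h: "bounded_bilinear h" and I: "open I" "is_interval I" "s0 \<in> I" and A: "continuous_on I A"
  obtains X where "X s0 = x0" "\<And>t. t \<in> I \<Longrightarrow> (X has_vector_derivative h (A t) (X t)) (at t)"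
proof -
  interpret h: bounded_bilinear h
    by (rule h)
  have "\<forall>f :: real \<Rightarrow> 'b. \<exists>F. continuous_on I f \<longrightarrow>
      F s0 = 0 \<and> (\<forall>t\<in>I. (F has_vector_derivative f t) (at t))"
    using antiderivative_on_open_interval[OF I] by metis
  then obtain J :: "(real \<Rightarrow> 'b) \<Rightarrow> real \<Rightarrow> 'b" where
    J: "\<And>f. continuous_on I f \<Longrightarrow> J f s0 = 0"
       "\<And>f t. continuous_on I f \<Longrightarrow> t \<in> I \<Longrightarrow> (J f has_vector_derivative f t) (at t)"
    by metis
  \<comment> \<open>the Picard increments: each one is the antiderivative, vanishing at \<open>s0\<close>, of \<open>h A\<close> applied to the one before\<close>
  define D where "D = rec_nat (\<lambda>_. x0) (\<lambda>_ d. J (\<lambda>t. h (A t) (d t)))"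
  have D0: "D 0 = (\<lambda>_. x0)" and D_Suc: "D (Suc n) = J (\<lambda>t. h (A t) (D n t))" for n
    by (simp_all add: D_def)
  have cont_D: "continuous_on I (D n)" for n
  proof (induction n)
    case (Suc n)
    then have "continuous_on I (\<lambda>t. h (A t) (D n t))"
      by (intro h.continuous_on A)
    from J(2)[OF this] show ?case
      unfolding D_Suc by (intro continuous_on_vector_derivative) (auto intro: has_vector_derivative_at_within)
  qed (simp add: D0)
  have cont_hD: "continuous_on I (\<lambda>t. h (A t) (D n t))" for n
    by (intro h.continuous_on A cont_D)
  have D_s0: "D (Suc n) s0 = 0" for n
    unfolding D_Suc by (rule J(1)[OF cont_hD])
  have der_D: "(D (Suc n) has_vector_derivative h (A t) (D n t)) (at t)" if "t \<in> I" for n t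
    unfolding D_Suc by (rule J(2)[OF cont_hD that])
  \<comment> \<open>the series of derivatives is the image of the series itself under \<open>h A\<close>, shifted by one place, with \<open>0\<close> in front\<close>
  define D' where "D' = (\<lambda>n t. case n of 0 \<Rightarrow> 0 | Suc m \<Rightarrow> h (A t) (D m t))"
  have D'_simps: "D' 0 t = 0" "D' (Suc n) t = h (A t) (D n t)" for n t
    by (simp_all add: D'_def)
  have der_D': "(D n has_vector_derivative D' n t) (at t)" if "t \<in> I" for n t
    using der_D[OF that] by (cases n) (simp_all add: D'_def D0)
  define X where "X = (\<lambda>t. \<Sum>n. D n t)"
  show ?thesis
  proof
    have "(\<Sum>n. D n s0) = (\<Sum>n\<in>{0}. D n s0)"
      by (rule suminf_finite) (auto simp: D_s0 gr0_conv_Suc)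
    then show "X s0 = x0"
      by (simp add: X_def D0)
    show "(X has_vector_derivative h (A t) (X t)) (at t)" if t: "t \<in> I" for t
    proof -
      obtain a b where ab: "a < s0" "s0 < b" "a < t" "t < b" "{a..b} \<subseteq> I"
        using open_interval_compact_neighbourhood[OF I t] .
      obtain K where K: "0 \<le> K" "\<And>u x. u \<in> {a..b} \<Longrightarrow> norm (h (A u) x) \<le> K * norm x"
        using bounded_bilinear_compact_bound[OF h compact_Icc continuous_on_subset[OF A ab(5)]]
        by blast
      define M where "M = (\<lambda>n. norm x0 * (K * (b - a)) ^ n / fact n)"
      have summable_M: "summable M"
        unfolding M_def by (rule power_over_fact_summable)
      have D_le: "norm (D n u) \<le> M n" if u: "u \<in> {a..b}" for n u
      proof -
        have "norm (D n u) \<le> norm x0 * (K * \<bar>u - s0\<bar>) ^ n / fact n"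
          using ab u K der_D D_s0 by (intro iterated_growth_bound[where f'=D']) (auto simp: D0 D'_simps)
        also have "\<dots> \<le> M n"
          unfolding M_def using ab u K(1)
          by (intro divide_right_mono mult_left_mono power_mono) auto
        finally show ?thesis .
      qed
      have D'_le: "norm (D' n u) \<le> K * M (n - 1)" if "u \<in> {a..b}" for n u
      proof (cases n)
        case 0
        then show ?thesis
          using K(1) by (simp add: D'_simps M_def)
      next
        case (Suc m)
        then show ?thesis
          using K(2)[OF that, of "D m u"] mult_left_mono[OF D_le[OF that] K(1), of m]
          by (simp add: D'_simps)
      qed
      have sums_X: "(\<lambda>n. D n u) sums X u" if "u \<in> {a..b}" for u
        unfolding X_def
        by (rule summable_sums[OF summable_comparison_test'[OF summable_M]]) (rule D_le[OF that])
      have D'_sums: "(\<lambda>n. D' n u) sums h (A u) (X u)" if "u \<in> {a..b}" for u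
      proof -
        have "(\<lambda>n. D' (Suc n) u) sums h (A u) (X u)"
          unfolding D'_simps by (rule bounded_linear.sums[OF h.bounded_linear_right sums_X[OF that]])
        from sums_Suc[OF this] show ?thesis
          by (simp add: D'_simps)
      qed
      have "summable (\<lambda>n. K * M (n - 1))"
        using summable_mult[OF summable_M, of K] by (subst summable_Suc_iff[symmetric]) simp
      then have "uniform_limit {a..b} (\<lambda>n u. \<Sum>i<n. D' i u) (\<lambda>u. \<Sum>i. D' i u) sequentially"
        by (intro Weierstrass_m_test[of _ _ "\<lambda>n. K * M (n - 1)"] D'_le) auto
      then have lim: "uniform_limit {a..b} (\<lambda>n u. \<Sum>i<n. D' i u) (\<lambda>u. h (A u) (X u)) sequentially"
        by (rule uniform_limit_cong'[THEN iffD1, rotated 2]) (use D'_sums in \<open>auto simp: sums_iff\<close>)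
      have "\<exists>g. \<forall>u\<in>{a..b}. (\<lambda>n. D n u) sums g u \<and>
          (g has_derivative (\<lambda>r. r *\<^sub>R h (A u) (X u))) (at u within {a..b})"
      proof (rule has_derivative_series)
        show "(D n has_derivative (\<lambda>r. r *\<^sub>R D' n u)) (at u within {a..b})" if "u \<in> {a..b}" for n u
          using has_vector_derivative_at_within[OF der_D'] that ab(5)
          unfolding has_vector_derivative_def by blast
        show "\<forall>\<^sub>F n in sequentially. \<forall>u\<in>{a..b}. \<forall>r.
            norm ((\<Sum>i<n. r *\<^sub>R D' i u) - r *\<^sub>R h (A u) (X u)) \<le> e * norm r" if "0 < e" for e
          using lim[unfolded uniform_limit_iff, rule_format, OF that]
        proof (rule eventually_mono, intro ballI allI)
          fix n u r assume *: "\<forall>u\<in>{a..b}. dist (\<Sum>i<n. D' i u) (h (A u) (X u)) < e" "u \<in> {a..b}"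
          have "norm ((\<Sum>i<n. r *\<^sub>R D' i u) - r *\<^sub>R h (A u) (X u)) =
              \<bar>r\<bar> * norm ((\<Sum>i<n. D' i u) - h (A u) (X u))"
            by (simp flip: scaleR_sum_right scaleR_diff_right)
          also have "\<dots> \<le> \<bar>r\<bar> * e"
            using * by (intro mult_left_mono) (auto simp: dist_norm intro: less_imp_le)
          finally show "norm ((\<Sum>i<n. r *\<^sub>R D' i u) - r *\<^sub>R h (A u) (X u)) \<le> e * norm r"
            by (simp add: mult.commute)
        qed
        show "t \<in> {a..b}" "(\<lambda>n. D n t) sums X t"
          using sums_X ab by auto
      qed simp
      then obtain g where g: "\<And>u. u \<in> {a..b} \<Longrightarrow> (\<lambda>n. D n u) sums g u"
        "\<And>u. u \<in> {a..b} \<Longrightarrow> (g has_vector_derivative h (A u) (X u)) (at u within {a..b})"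
        unfolding has_vector_derivative_def by blast
      have "(g has_vector_derivative h (A t) (X t)) (at t)"
        using g(2)[of t] ab at_within_Icc_at[of a t b] by simp
      then show ?thesis
        by (rule has_vector_derivative_transform_within_open[of _ _ _ "{a<..<b}"])
           (use ab sums_unique2[OF g(1) sums_X] in auto)
    qed
  qed
qed

section \<open>Lorentzian linear algebra\<close>

lemmas lorentz_coordinates = lorentz_def lorentz_cross_def Zmat_def cross3_def
  matrix_vector_mult_def vec_eq_iff forall_3 sum_3

lemma bounded_bilinear_lorentz: "bounded_bilinear lorentz"
  unfolding bilinear_conv_bounded_bilinear[symmetric] bilinear_def linear_iff
  by (simp add: lorentz_def algebra_simps)

lemma bounded_bilinear_lorentz_cross: "bounded_bilinear lorentz_cross"
  unfolding bilinear_conv_bounded_bilinear[symmetric] bilinear_def linear_iff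
  by (simp add: lorentz_coordinates algebra_simps)

lemma bounded_bilinear_matrix_mult:
  "bounded_bilinear ((**) :: real^'n^'m \<Rightarrow> real^'p^'n \<Rightarrow> real^'p^'m)"
  unfolding bilinear_conv_bounded_bilinear[symmetric] bilinear_def linear_iff
  by (simp add: matrix_matrix_mult_def vec_eq_iff sum.distrib sum_distrib_left algebra_simps)

lemma lorentz_commute: "lorentz v w = lorentz w v"
  by (simp add: lorentz_def)

lemmas lorentz_linear =
  bounded_bilinear.diff_right[OF bounded_bilinear_lorentz]
  bounded_bilinear.diff_left[OF bounded_bilinear_lorentz]
  bounded_bilinear.scaleR_right[OF bounded_bilinear_lorentz]
  bounded_bilinear.scaleR_left[OF bounded_bilinear_lorentz]
  bounded_bilinear.add_right[OF bounded_bilinear_lorentz]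
  bounded_bilinear.add_left[OF bounded_bilinear_lorentz]
  bounded_bilinear.minus_right[OF bounded_bilinear_lorentz]
  bounded_bilinear.minus_left[OF bounded_bilinear_lorentz]
  bounded_bilinear.zero_left[OF bounded_bilinear_lorentz]

lemma lorentz_cross_norm:
  "lorentz (lorentz_cross v w) (lorentz_cross v w) = (lorentz v w)\<^sup>2 - lorentz v v * lorentz w w"
  by (simp add: lorentz_coordinates power2_eq_square algebra_simps)

lemma lorentz_cross_orthogonal:
  "lorentz (lorentz_cross v w) v = 0" "lorentz (lorentz_cross v w) w = 0"
  by (simp_all add: lorentz_coordinates algebra_simps)

lemma lorentz_cross_triple:
  "lorentz_cross u (lorentz_cross v w) = lorentz u v *\<^sub>R w - lorentz u w *\<^sub>R v"
  by (simp add: lorentz_coordinates algebra_simps)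

lemma lorentz_cross_self: "lorentz_cross v v = 0"
  by (simp add: lorentz_coordinates)

lemma lorentz_cross_swap: "lorentz_cross w v = - lorentz_cross v w"
  by (simp add: lorentz_coordinates algebra_simps)

lemma lorentz_cross_cyclic: "lorentz (lorentz_cross u v) w = lorentz (lorentz_cross v w) u"
  by (simp add: lorentz_coordinates algebra_simps)

text \<open>
  Cramer's rule: the coordinates of \<open>x\<close> with respect to \<open>u\<close>, \<open>v\<close>, \<open>w\<close> are quotients of
  determinants. Without denominators the identity also covers dependent vectors.
\<close>
lemma lorentz_cramer:
  "lorentz (lorentz_cross u v) w *\<^sub>R x = lorentz (lorentz_cross v w) x *\<^sub>R u +
     lorentz (lorentz_cross w u) x *\<^sub>R v + lorentz (lorentz_cross u v) x *\<^sub>R w"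
  by (simp add: lorentz_coordinates algebra_simps)

text \<open>
  The form is positive definite on the horizontal plane.
\<close>
lemma lorentz_null_horizontal_eq_0: "lorentz v v = 0 \<Longrightarrow> v $ 3 = 0 \<Longrightarrow> v = 0"
  by (simp add: lorentz_def vec_eq_iff forall_3 flip: power2_eq_square)

text \<open>
  On the Lorentzian plane orthogonal to the unit vector \<open>e\<close>, the map \<open>v \<mapsto> e \<times> v\<close> is an involution
  whose eigenlines, for the eigenvalues \<open>1\<close> and \<open>- 1\<close>, are the two null lines of the plane. This is what
  makes the sign of a curvature-lightlike point well defined.
\<close>
lemma cross_null_eigenvector:
  assumes "lorentz e e = 1" "lorentz e k = 0" "lorentz k k = 0"
  shows "\<exists>\<epsilon>\<in>{1, - 1}. lorentz_cross e k = \<epsilon> *\<^sub>R k"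
proof -
  \<comment> \<open>the third coordinates agree up to a sign; with this sign, the difference of the two vectors is null and horizontal\<close>
  have "(lorentz_cross e k $ 3)\<^sup>2 = (k $ 3)\<^sup>2"
    using assms by (simp add: lorentz_coordinates) algebra
  then have "\<exists>\<epsilon>\<in>{1, - 1}. lorentz_cross e k $ 3 = \<epsilon> * k $ 3"
    unfolding power2_eq_iff by simp
  then obtain \<epsilon> where \<epsilon>: "\<epsilon> \<in> {1, - 1}" "lorentz_cross e k $ 3 = \<epsilon> * k $ 3" ..
  have "lorentz (lorentz_cross e k - \<epsilon> *\<^sub>R k) (lorentz_cross e k - \<epsilon> *\<^sub>R k) = 0"
    using lorentz_cross_norm[of e k] lorentz_cross_orthogonal[of e k] assms
    by (simp add: lorentz_linear lorentz_commute[of k "lorentz_cross e k"])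
  with \<epsilon> have "lorentz_cross e k - \<epsilon> *\<^sub>R k = 0"
    by (intro lorentz_null_horizontal_eq_0) simp_all
  then show ?thesis
    using \<epsilon>(1) by auto
qed

text \<open>
  For unit \<open>e\<close> and \<open>\<epsilon> = \<plusminus> 1\<close> this is, up to the factor \<open>2\<close>, the image of the vertical unit vector under the projection to the plane
  orthogonal to \<open>e\<close> followed by the projection to the eigenline of \<open>v \<mapsto> e \<times> v\<close> for the eigenvalue \<open>- \<epsilon>\<close>.
  The vertical vector is timelike, so it does not lie in the kernel of the composition. The result is a
  generator, smooth in \<open>e\<close>, of the null line that contains the pseudo-binormal vector.
\<close>
definition null_normal :: "real \<Rightarrow> real^3 \<Rightarrow> real^3" where
  "null_normal \<epsilon> e = axis 3 1 - lorentz (axis 3 1) e *\<^sub>R e - \<epsilon> *\<^sub>R lorentz_cross e (axis 3 1)"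

lemma null_normal_component_3: "null_normal \<epsilon> e $ 3 = 1 + (e $ 3)\<^sup>2"
  by (simp add: null_normal_def lorentz_coordinates axis_def power2_eq_square)

lemma null_normal_orthogonal: "lorentz e e = 1 \<Longrightarrow> lorentz e (null_normal \<epsilon> e) = 0"
  by (simp add: null_normal_def lorentz_coordinates axis_def) algebra

lemma null_normal_null:
  assumes "lorentz e e = 1" "\<epsilon> \<in> {1, - 1}"
  shows "lorentz (null_normal \<epsilon> e) (null_normal \<epsilon> e) = 0"
proof -
  have "\<epsilon> * \<epsilon> = 1"
    using assms(2) by auto
  with assms(1) show ?thesis
    by (simp add: null_normal_def lorentz_coordinates axis_def) algebra
qed

text \<open>
  Both \<open>k - \<epsilon> (e \<times> k)\<close> and the null normal lie on the eigenline for \<open>- \<epsilon>\<close>, and the inner product with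
  \<open>k\<close> determines the factor between them. The equation \<open>\<theta> \<beta> = \<kappa> - \<epsilon> (e \<times> \<kappa>)\<close> is thus solved by
  a multiple of the null normal, without a division by \<open>\<theta>\<close>.
\<close>
lemma null_normal_decomposition:
  assumes "lorentz e e = 1" "lorentz e k = 0" "\<epsilon> \<in> {1, - 1}"
  shows "lorentz k (null_normal \<epsilon> e) *\<^sub>R (k - \<epsilon> *\<^sub>R lorentz_cross e k) = lorentz k k *\<^sub>R null_normal \<epsilon> e"
proof -
  let ?n = "null_normal \<epsilon> e" and ?p = "lorentz_cross e k"
  note blc = bounded_bilinear_lorentz_cross
  have \<epsilon>: "\<epsilon> * \<epsilon> = 1"
    using assms(3) by auto
  \<comment> \<open>the null normal is an eigenvector for \<open>- \<epsilon>\<close>\<close>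
  have "lorentz_cross e ?n = - \<epsilon> *\<^sub>R ?n"
    using \<epsilon>
    by (simp add: lorentz_cross_self null_normal_def bounded_bilinear.diff_right[OF blc] bounded_bilinear.scaleR_right[OF blc]
        lorentz_cross_triple assms(1) lorentz_commute[of e "axis 3 1"] scaleR_diff_right)
  then have p: "lorentz ?p ?n = \<epsilon> * lorentz k ?n"
    using lorentz_cross_cyclic[of k ?n e] lorentz_cross_cyclic[of e k ?n] lorentz_cross_swap[of ?n e]
    by (simp add: lorentz_linear lorentz_commute[of ?n])
  \<comment> \<open>Cramer's rule for \<open>e\<close>, \<open>k\<close>, \<open>e \<times> k\<close>, which as an identity without denominators also holds for null \<open>k\<close>, where these vectors are dependent\<close>
  have "- lorentz k k *\<^sub>R ?n = - lorentz k ?n *\<^sub>R k + lorentz ?p ?n *\<^sub>R ?p"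
    using lorentz_cramer[of e k ?p ?n] lorentz_cross_norm[of e k] null_normal_orthogonal[OF assms(1), of \<epsilon>]
      lorentz_cross_triple[of k e k] lorentz_cross_triple[of e e k] lorentz_cross_swap[of ?p e] assms(1,2)
    by (simp add: lorentz_commute[of k e] lorentz_linear)
  then show ?thesis
    by (simp add: p scaleR_diff_right algebra_simps)
qed

text \<open>
  If the inner product vanished, the preceding lemma would force \<open>k\<close> to be null. By the condition on
  the sign, \<open>k\<close> would then span the other null line, and its inner product with the null normal would be
  \<open>- 2 k\<^sub>3\<close>, which is not zero for a nonzero null vector.
\<close>
lemma null_normal_transversal:
  assumes "lorentz e e = 1" "lorentz e k = 0" "\<epsilon> \<in> {1, - 1}" "k \<noteq> 0"
    and sign: "lorentz k k = 0 \<Longrightarrow> lorentz_cross e k = \<epsilon> *\<^sub>R k"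
  shows "lorentz k (null_normal \<epsilon> e) \<noteq> 0"
proof
  assume 0: "lorentz k (null_normal \<epsilon> e) = 0"
  have "null_normal \<epsilon> e $ 3 > 0"
    unfolding null_normal_component_3 by (simp add: add_pos_nonneg)
  then have "null_normal \<epsilon> e \<noteq> 0"
    by auto
  then have null: "lorentz k k = 0"
    using null_normal_decomposition[OF assms(1-3)] 0 by simp
  have "lorentz k (null_normal \<epsilon> e) =
      - (k $ 3) - lorentz (axis 3 1) e * lorentz e k - \<epsilon> * lorentz_cross e k $ 3"
    by (simp add: null_normal_def lorentz_coordinates axis_def algebra_simps)
  then have "k $ 3 = 0"
    using 0 assms(2,3) sign[OF null] by auto
  with null \<open>k \<noteq> 0\<close> show False
    using lorentz_null_horizontal_eq_0 by blast
qed

lemma det_eq_lorentz_cross: "det X = lorentz (lorentz_cross (X $ 1) (X $ 2)) (X $ 3)"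
  by (simp add: det_3 lorentz_coordinates algebra_simps)

lemma gram_component: "(X ** Zmat ** transpose X) $ i $ j = lorentz (X $ i) (X $ j)"
  by (simp add: matrix_matrix_mult_def lorentz_coordinates transpose_def)

lemma det_Zmat: "det Zmat = - 1"
  by (simp add: det_3 Zmat_def)

lemma invertible_rows_orthogonal_eq_0:
  assumes "det X \<noteq> 0" "\<And>i. lorentz (X $ i) v = 0"
  shows "v = 0"
proof -
  have "X *v (Zmat *v v) = 0"
    using assms(2) by (simp add: vec_eq_iff lorentz_coordinates matrix_vector_mult_def)
  then have "Zmat *v v = 0"
    using assms(1) invertible_det_nz matrix_left_invertible_ker[of X] unfolding invertible_def by blast
  then show ?thesis
    by (simp add: lorentz_coordinates)
qed

text \<open>
  The inner products of \<open>e\<close>, \<open>\<kappa>\<close> and \<open>\<beta>\<close>.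
\<close>
definition gram_matrix :: "real \<Rightarrow> real^3^3" where
  "gram_matrix \<theta> = vector [vector [1, 0, 0], vector [0, \<theta>, 1], vector [0, 1, 0]]"

text \<open>
  The coefficients of the equations \<open>e' = \<kappa>\<close>, \<open>\<kappa>' = - \<theta> e - \<mu> \<kappa> + (\<theta>'/2 + \<theta> \<mu>) \<beta>\<close> and
  \<open>\<beta>' = - e + \<mu> \<beta>\<close>, where \<open>e\<close>, \<open>\<kappa>\<close>, \<open>\<beta>\<close> are the rows of the matrix that is multiplied.
\<close>
definition frame_matrix :: "real \<Rightarrow> real \<Rightarrow> real \<Rightarrow> real^3^3" where
  "frame_matrix \<theta> \<theta>' \<mu> =
     vector [vector [0, 1, 0], vector [- \<theta>, - \<mu>, \<theta>' / 2 + \<theta> * \<mu>], vector [- 1, 0, \<mu>]]"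

lemma gram_matrix_iff:
  "X ** Zmat ** transpose X = gram_matrix \<theta> \<longleftrightarrow>
     lorentz (X $ 1) (X $ 1) = 1 \<and> lorentz (X $ 1) (X $ 2) = 0 \<and> lorentz (X $ 1) (X $ 3) = 0 \<and>
     lorentz (X $ 2) (X $ 2) = \<theta> \<and> lorentz (X $ 2) (X $ 3) = 1 \<and> lorentz (X $ 3) (X $ 3) = 0"
  unfolding vec_eq_iff forall_3 gram_component
  by (auto simp: gram_matrix_def lorentz_commute)

lemma frame_matrix_mult_rows:
  "(frame_matrix \<theta> \<theta>' \<mu> ** X) $ 1 = X $ 2"
  "(frame_matrix \<theta> \<theta>' \<mu> ** X) $ 2 = - \<theta> *\<^sub>R X $ 1 - \<mu> *\<^sub>R X $ 2 + (\<theta>' / 2 + \<theta> * \<mu>) *\<^sub>R X $ 3"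
  "(frame_matrix \<theta> \<theta>' \<mu> ** X) $ 3 = - X $ 1 + \<mu> *\<^sub>R X $ 3"
  by (simp_all add: frame_matrix_def matrix_matrix_mult_def vec_eq_iff sum_3)

lemma gram_det_squared:
  assumes "X ** Zmat ** transpose X = gram_matrix \<theta>"
  shows "(det X)\<^sup>2 = 1"
proof -
  have "det X * det Zmat * det X = det (gram_matrix \<theta>)"
    by (simp only: det_mul det_transpose flip: assms)
  also have "det (gram_matrix \<theta>) = - 1"
    by (simp add: gram_matrix_def det_3)
  finally show ?thesis
    by (simp add: det_Zmat power2_eq_square)
qed

text \<open>
  The two sides of the vector equation have the same inner products with the first two rows, and the
  inner product of the left-hand side with the third row is the determinant. The defining equation of
  the pseudo-binormal vector is thus a condition on the orientation of the frame.
\<close>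
lemma frame_cross_iff:
  assumes gram: "X ** Zmat ** transpose X = gram_matrix \<theta>" and \<epsilon>: "\<epsilon> \<in> {1, - 1}"
  shows "det X = \<epsilon> \<longleftrightarrow>
    lorentz_cross (X $ 1) (X $ 2) = \<epsilon> *\<^sub>R (X $ 2 - \<theta> *\<^sub>R X $ 3)" (is "_ \<longleftrightarrow> ?c = ?v")
proof
  note g = gram[unfolded gram_matrix_iff]
  {
    assume "?c = ?v"
    then show "det X = \<epsilon>"
      using g by (simp add: det_eq_lorentz_cross lorentz_linear)
  next
    assume det: "det X = \<epsilon>"
    have "?c - ?v = 0"
    proof (rule invertible_rows_orthogonal_eq_0)
      show "det X \<noteq> 0"
        using det \<epsilon> by auto
      have "\<forall>i. lorentz (X $ i) (?c - ?v) = 0"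
        unfolding forall_3 lorentz_linear lorentz_commute[of _ ?c]
          lorentz_commute[of "X $ 2" "X $ 1"] lorentz_commute[of "X $ 3" "X $ 2"]
          lorentz_commute[of "X $ 3" "X $ 1"]
        using g det[unfolded det_eq_lorentz_cross] lorentz_cross_orthogonal[of "X $ 1" "X $ 2"]
        by simp
      then show "lorentz (X $ i) (?c - ?v) = 0" for i ..
    qed
    then show "?c = ?v"
      by simp
  }
qed

lemma has_vector_derivative_vec_nth:
  "(X has_vector_derivative X') F \<Longrightarrow> ((\<lambda>t. X t $ i) has_vector_derivative X' $ i) F"
  by (rule bounded_linear.has_vector_derivative[OF bounded_linear_vec_nth])

lemma has_vector_derivative_vecI:
  fixes X :: "real \<Rightarrow> 'a::real_normed_vector ^ 'n"
  assumes "\<And>i. ((\<lambda>t. X t $ i) has_vector_derivative X' $ i) (at s)"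
  shows "(X has_vector_derivative X') (at s)"
  using assms unfolding has_vector_derivative_def has_derivative_def
  by (auto intro!: vec_tendstoI bounded_linear_scaleR_left)

lemma continuous_on_vecI:
  "(\<And>i. continuous_on S (\<lambda>t. X t $ i)) \<Longrightarrow> continuous_on S X"
  using continuous_on_vec_lambda[of S "\<lambda>i t. X t $ i"] by simp

lemma derivative_eq_on_open:
  assumes "open S" "s \<in> S" "\<And>t. t \<in> S \<Longrightarrow> f t = g t"
    and "(f has_vector_derivative f') (at s)" "(g has_vector_derivative g') (at s)"
  shows "f' = g'"
  using has_vector_derivative_transform_within_open[OF assms(4,1,2,3)] assms(5)
  by (rule vector_derivative_unique_at)

section \<open>The frame of a curve\<close>

definition realizes :: "real set \<Rightarrow> real \<Rightarrow> (real \<Rightarrow> real) \<Rightarrow> (real \<Rightarrow> real) \<Rightarrow> real \<Rightarrow> (real \<Rightarrow> real^3) \<Rightarrow> bool" where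
  "realizes I s0 \<theta> \<mu> \<epsilon> \<gamma> \<longleftrightarrow>
     unit_speed_spacelike_curve I \<gamma> \<and> nonzero_curvature_vector I \<gamma> \<and>
     (\<forall>s\<in>I. causal_curvature \<gamma> s = \<theta> s) \<and> (\<forall>s\<in>I. pseudo_torsion I \<gamma> s0 s = \<mu> s) \<and>
     curve_sign \<gamma> s0 = \<epsilon>"

text \<open>
  The rows of \<open>X s\<close> stand for the tangent, curvature and pseudo-binormal vectors. The determinant
  extends the sign, which the curve itself provides only at \<open>s0\<close>, to all of \<open>I\<close>.
\<close>
definition pseudo_frame ::
  "real set \<Rightarrow> (real \<Rightarrow> real) \<Rightarrow> (real \<Rightarrow> real) \<Rightarrow> real \<Rightarrow> (real \<Rightarrow> real^3^3) \<Rightarrow> bool" where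
  "pseudo_frame I \<theta> \<mu> \<epsilon> X \<longleftrightarrow> (\<forall>s\<in>I.
     (X has_vector_derivative frame_matrix (\<theta> s) (vderiv \<theta> s) (\<mu> s) ** X s) (at s) \<and>
     X s ** Zmat ** transpose (X s) = gram_matrix (\<theta> s) \<and> det (X s) = \<epsilon>)"

lemma curve_derivatives:
  assumes "unit_speed_spacelike_curve I \<gamma>" "s \<in> I"
  shows "(\<gamma> has_vector_derivative vderiv \<gamma> s) (at s)"
    and "(vderiv \<gamma> has_vector_derivative curvature_vector \<gamma> s) (at s)"
    and "(curvature_vector \<gamma> has_vector_derivative vderiv (curvature_vector \<gamma>) s) (at s)"
  using assms unfolding unit_speed_spacelike_curve_def curvature_vector_def
  by (auto intro!: smooth_on_has_vector_derivative intro: smooth_on_vderiv)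

lemma curve_curvature_orthogonal:
  assumes "open I" "unit_speed_spacelike_curve I \<gamma>" "s \<in> I"
  shows "lorentz (vderiv \<gamma> s) (curvature_vector \<gamma> s) = 0"
proof -
  note der = curve_derivatives(2)[OF assms(2,3)]
  have "lorentz (vderiv \<gamma> s) (curvature_vector \<gamma> s) + lorentz (curvature_vector \<gamma> s) (vderiv \<gamma> s) = 0"
    using assms(2) unfolding unit_speed_spacelike_curve_def
    by (intro derivative_eq_on_open[OF assms(1,3) _
          bounded_bilinear.has_vector_derivative[OF bounded_bilinear_lorentz der der]
          has_vector_derivative_const[of 1]]) blast
  then show ?thesis
    by (simp add: lorentz_commute)
qed

lemma curve_sign_eqI:
  assumes "\<epsilon> \<in> {1, - 1}" "curvature_vector \<gamma> s0 \<noteq> 0"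
    and "lorentz_cross (vderiv \<gamma> s0) (curvature_vector \<gamma> s0) = \<epsilon> *\<^sub>R curvature_vector \<gamma> s0"
  shows "curve_sign \<gamma> s0 = \<epsilon>"
  unfolding curve_sign_def
proof (rule the_equality)
  show "\<epsilon> \<in> {1, - 1} \<and>
      lorentz_cross (vderiv \<gamma> s0) (curvature_vector \<gamma> s0) = \<epsilon> *\<^sub>R curvature_vector \<gamma> s0"
    using assms by blast
  show "\<epsilon>' = \<epsilon>" if "\<epsilon>' \<in> {1, - 1} \<and>
      lorentz_cross (vderiv \<gamma> s0) (curvature_vector \<gamma> s0) = \<epsilon>' *\<^sub>R curvature_vector \<gamma> s0" for \<epsilon>'
    using that assms(2) unfolding assms(3) by simp
qed

lemma curve_sign_cross:
  assumes "open I" "unit_speed_spacelike_curve I \<gamma>" "nonzero_curvature_vector I \<gamma>" "s0 \<in> I"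
    and "causal_curvature \<gamma> s0 = 0"
  shows "lorentz_cross (vderiv \<gamma> s0) (curvature_vector \<gamma> s0) =
    curve_sign \<gamma> s0 *\<^sub>R curvature_vector \<gamma> s0"
proof -
  have unit: "lorentz (vderiv \<gamma> s0) (vderiv \<gamma> s0) = 1" and nz: "curvature_vector \<gamma> s0 \<noteq> 0"
    using assms by (simp_all add: unit_speed_spacelike_curve_def nonzero_curvature_vector_def)
  obtain \<epsilon> where \<epsilon>: "\<epsilon> \<in> {1, - 1}"
      "lorentz_cross (vderiv \<gamma> s0) (curvature_vector \<gamma> s0) = \<epsilon> *\<^sub>R curvature_vector \<gamma> s0"
    using cross_null_eigenvector[OF unit curve_curvature_orthogonal[OF assms(1,2,4)]] assms(5)
    unfolding causal_curvature_def by blast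
  with curve_sign_eqI[OF \<epsilon>(1) nz \<epsilon>(2)] show ?thesis
    by simp
qed

text \<open>
  The choice in \<^const>\<open>pseudo_binormal\<close> is meaningful only once a pseudo-binormal field is known to
  exist.
\<close>
lemma pseudo_binormal_eqI:
  assumes "open I" "s0 \<in> I" "curve_sign \<gamma> s0 \<noteq> 0" "is_pseudo_binormal I \<gamma> s0 \<beta>" "s \<in> I"
    and "\<And>s. s \<in> I \<Longrightarrow> causal_curvature \<gamma> s = 0 \<Longrightarrow> s = s0"
  shows "pseudo_binormal I \<gamma> s0 s = \<beta> s"
proof -
  have "is_pseudo_binormal I \<gamma> s0 (pseudo_binormal I \<gamma> s0)"
    unfolding pseudo_binormal_def by (rule someI[of _ \<beta>]) (rule assms(4))
  then show ?thesis
    using is_pseudo_binormal_unique[OF assms(1,2,6,3) _ assms(4,5)] by blast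
qed

text \<open>
  The pseudo-binormal field is \<open>n / \<langle>\<kappa>, n\<rangle>\<close> with the null normal \<open>n\<close> along the curve. It is smooth
  across \<open>s0\<close> because the denominator vanishes nowhere. This is where non-zero curvature and the sign at \<open>s0\<close>
  enter. The frame equation follows by differentiating the inner products of the frame vectors, since a
  vector is determined by its inner products with a basis.
\<close>
lemma realized_curve_has_frame:
  assumes I: "open I" "s0 \<in> I" and \<epsilon>: "\<epsilon> \<in> {1, - 1}" and \<theta>: "smooth_on I \<theta>"
    and zero: "\<forall>s\<in>I. \<theta> s = 0 \<longleftrightarrow> s = s0" and \<gamma>: "realizes I s0 \<theta> \<mu> \<epsilon> \<gamma>"
  obtains X where "pseudo_frame I \<theta> \<mu> \<epsilon> X" "\<And>s. s \<in> I \<Longrightarrow> X s $ 1 = vderiv \<gamma> s"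
proof -
  define e where "e = vderiv \<gamma>"
  define k where "k = curvature_vector \<gamma>"
  define n where "n = (\<lambda>s. null_normal \<epsilon> (e s))"
  define \<beta> where "\<beta> = (\<lambda>s. inverse (lorentz (k s) (n s)) *\<^sub>R n s)"
  note bl = bounded_bilinear_lorentz
  have curve: "unit_speed_spacelike_curve I \<gamma>" "nonzero_curvature_vector I \<gamma>"
    and sgn: "curve_sign \<gamma> s0 = \<epsilon>"
    and torsion: "\<And>s. s \<in> I \<Longrightarrow> pseudo_torsion I \<gamma> s0 s = \<mu> s"
    and causal: "\<And>s. s \<in> I \<Longrightarrow> causal_curvature \<gamma> s = \<theta> s"
    using \<gamma> unfolding realizes_def by blast+
  have ee: "lorentz (e s) (e s) = 1" if "s \<in> I" for s
    using curve(1) that unfolding unit_speed_spacelike_curve_def e_def by blast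
  have ek: "lorentz (e s) (k s) = 0" if "s \<in> I" for s
    unfolding e_def k_def by (rule curve_curvature_orthogonal[OF I(1) curve(1) that])
  have kk: "lorentz (k s) (k s) = \<theta> s" if "s \<in> I" for s
    using causal[OF that] unfolding causal_curvature_def k_def .
  have k_nz: "k s \<noteq> 0" if "s \<in> I" for s
    using curve(2) that unfolding nonzero_curvature_vector_def k_def by blast
  have cross_null: "lorentz_cross (e s) (k s) = \<epsilon> *\<^sub>R k s" if "s \<in> I" "lorentz (k s) (k s) = 0" for s
  proof -
    have "s = s0"
      using zero that kk by simp
    then show ?thesis
      using curve_sign_cross[OF I(1) curve I(2)] causal[OF I(2)] zero I(2)
      unfolding sgn e_def k_def by simp
  qed
  have kn: "lorentz (k s) (n s) \<noteq> 0" if "s \<in> I" for s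
    unfolding n_def using ee[OF that] ek[OF that] \<epsilon> k_nz[OF that] cross_null[OF that]
    by (rule null_normal_transversal)
  have smooth_e: "smooth_on I e" and smooth_k: "smooth_on I k"
    using curve(1) unfolding unit_speed_spacelike_curve_def e_def k_def curvature_vector_def
    by (auto intro!: smooth_on_vderiv)
  have smooth_n: "smooth_on I n"
    unfolding n_def null_normal_def
    by (intro smooth_on_diff smooth_on_scaleR smooth_on_const smooth_on_bilinear[OF bl]
        smooth_on_bilinear[OF bounded_bilinear_lorentz_cross] smooth_e I(1))
  have smooth_\<beta>: "smooth_on I \<beta>"
    unfolding \<beta>_def
    by (intro smooth_on_scaleR smooth_on_inverse smooth_on_bilinear[OF bl] smooth_k smooth_n I(1) kn)
  have \<theta>\<beta>: "\<theta> s *\<^sub>R \<beta> s = k s - \<epsilon> *\<^sub>R lorentz_cross (e s) (k s)" if "s \<in> I" for s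
  proof -
    have "lorentz (k s) (n s) *\<^sub>R (k s - \<epsilon> *\<^sub>R lorentz_cross (e s) (k s)) = \<theta> s *\<^sub>R n s"
      using null_normal_decomposition[OF ee[OF that] ek[OF that] \<epsilon>] kk[OF that] by (simp add: n_def)
    then have "inverse (lorentz (k s) (n s)) *\<^sub>R (\<theta> s *\<^sub>R n s) =
        inverse (lorentz (k s) (n s)) *\<^sub>R (lorentz (k s) (n s) *\<^sub>R (k s - \<epsilon> *\<^sub>R lorentz_cross (e s) (k s)))"
      by (rule arg_cong[OF sym])
    also have "\<dots> = k s - \<epsilon> *\<^sub>R lorentz_cross (e s) (k s)"
      unfolding scaleR_scaleR left_inverse[OF kn[OF that]] by simp
    finally show ?thesis
      by (simp add: \<beta>_def mult.commute)
  qed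
  have cross: "lorentz_cross (e s) (k s) = \<epsilon> *\<^sub>R (k s - \<theta> s *\<^sub>R \<beta> s)" if "s \<in> I" for s
    using \<theta>\<beta>[OF that] \<epsilon> by auto
  have "is_pseudo_binormal I \<gamma> s0 \<beta>"
    unfolding is_pseudo_binormal_def sgn using smooth_\<beta> cross causal by (simp add: e_def k_def)
  then have binormal: "pseudo_binormal I \<gamma> s0 s = \<beta> s" if "s \<in> I" for s
    using that by (rule pseudo_binormal_eqI[rotated 3]) (use I sgn \<epsilon> causal zero in auto)
  have \<beta>: "lorentz (e s) (\<beta> s) = 0" "lorentz (k s) (\<beta> s) = 1" "lorentz (\<beta> s) (\<beta> s) = 0" if "s \<in> I" for s
    using null_normal_orthogonal[OF ee[OF that]] null_normal_null[OF ee[OF that] \<epsilon>] kn[OF that]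
    by (simp_all add: \<beta>_def n_def lorentz_linear)
  define X where "X = (\<lambda>s. vector [e s, k s, \<beta> s] :: real^3^3)"
  have gram: "X s ** Zmat ** transpose (X s) = gram_matrix (\<theta> s)" if "s \<in> I" for s
    unfolding gram_matrix_iff using \<beta>[OF that] ee[OF that] ek[OF that] kk[OF that] by (simp add: X_def)
  have det: "det (X s) = \<epsilon>" if "s \<in> I" for s
    unfolding frame_cross_iff[OF gram[OF that] \<epsilon>] using cross[OF that] by (simp add: X_def)
  have der_e: "(e has_vector_derivative k s) (at s)"
    and der_k: "(k has_vector_derivative vderiv k s) (at s)"
    and der_\<beta>: "(\<beta> has_vector_derivative vderiv \<beta> s) (at s)" if "s \<in> I" for s
    using curve_derivatives[OF curve(1) that] smooth_on_has_vector_derivative[OF smooth_\<beta> that]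
    unfolding e_def k_def by auto
  have der_X: "(X has_vector_derivative frame_matrix (\<theta> s) (vderiv \<theta> s) (\<mu> s) ** X s) (at s)" if s: "s \<in> I" for s
  proof -
    have der_gram: "lorentz (f s) g' + lorentz f' (g s) = c'"
      if "(f has_vector_derivative f') (at s)" "(g has_vector_derivative g') (at s)"
        "\<And>t. t \<in> I \<Longrightarrow> lorentz (f t) (g t) = c t" "(c has_vector_derivative c') (at s)" for f g f' g' c c'
      using derivative_eq_on_open[OF I(1) s that(3)
          bounded_bilinear.has_vector_derivative[OF bl that(1,2)] that(4)] .
    note const = has_vector_derivative_const
    note g = ee[OF s] ek[OF s] kk[OF s] \<beta>[OF s]
    have ek': "lorentz (e s) (vderiv k s) + lorentz (k s) (k s) = 0"
      by (rule der_gram[OF der_e[OF s] der_k[OF s] ek const])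
    have kk': "lorentz (k s) (vderiv k s) + lorentz (vderiv k s) (k s) = vderiv \<theta> s"
      by (rule der_gram[OF der_k[OF s] der_k[OF s] kk smooth_on_has_vector_derivative[OF \<theta> s]])
    have e\<beta>': "lorentz (e s) (vderiv \<beta> s) + lorentz (k s) (\<beta> s) = 0"
      by (rule der_gram[OF der_e[OF s] der_\<beta>[OF s] \<beta>(1) const])
    have k\<beta>': "lorentz (k s) (vderiv \<beta> s) + lorentz (vderiv k s) (\<beta> s) = 0"
      by (rule der_gram[OF der_k[OF s] der_\<beta>[OF s] \<beta>(2) const])
    have \<beta>\<beta>': "lorentz (\<beta> s) (vderiv \<beta> s) + lorentz (vderiv \<beta> s) (\<beta> s) = 0"
      by (rule der_gram[OF der_\<beta>[OF s] der_\<beta>[OF s] \<beta>(3) const])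
    have \<mu>: "lorentz (vderiv k s) (\<beta> s) = - \<mu> s"
      using torsion[OF s] binormal[OF s] by (simp add: pseudo_torsion_def k_def)
    have orth: "v = w" if "lorentz (e s) v = lorentz (e s) w" "lorentz (k s) v = lorentz (k s) w"
      "lorentz (\<beta> s) v = lorentz (\<beta> s) w" for v w
    proof -
      have "\<forall>i. lorentz (X s $ i) (v - w) = 0"
        unfolding forall_3 using that by (simp add: X_def lorentz_linear)
      then have "v - w = 0"
        using det[OF s] \<epsilon> by (intro invertible_rows_orthogonal_eq_0[of "X s"]) auto
      then show ?thesis
        by simp
    qed
    note com = lorentz_commute[of "vderiv k s"] lorentz_commute[of "vderiv \<beta> s"]
      lorentz_commute[of "\<beta> s" "k s"] lorentz_commute[of "\<beta> s" "e s"] lorentz_commute[of "k s" "e s"]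
    have k': "vderiv k s = - \<theta> s *\<^sub>R e s - \<mu> s *\<^sub>R k s + (vderiv \<theta> s / 2 + \<theta> s * \<mu> s) *\<^sub>R \<beta> s"
      using ek' kk' \<mu> g by (intro orth) (simp_all add: lorentz_linear com algebra_simps)
    have \<beta>': "vderiv \<beta> s = - e s + \<mu> s *\<^sub>R \<beta> s"
      using e\<beta>' k\<beta>' \<beta>\<beta>' \<mu> g by (intro orth) (simp_all add: lorentz_linear com algebra_simps)
    have "\<forall>i. ((\<lambda>t. X t $ i) has_vector_derivative
        (frame_matrix (\<theta> s) (vderiv \<theta> s) (\<mu> s) ** X s) $ i) (at s)"
      unfolding forall_3 frame_matrix_mult_rows
      using der_e[OF s] der_k[OF s] der_\<beta>[OF s] k' \<beta>' by (simp add: X_def)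
    then show ?thesis
      by - (rule has_vector_derivative_vecI, blast)
  qed
  show ?thesis
    by (rule that[of X]) (use der_X gram det in \<open>auto simp: pseudo_frame_def X_def e_def\<close>)
qed

section \<open>Solutions of the frame equation\<close>

text \<open>
  The difference of two solutions is a solution with initial value zero.
\<close>
lemma matrix_ode_unique:
  fixes A :: "real \<Rightarrow> real^'n^'n" and X Y :: "real \<Rightarrow> real^'m^'n"
  assumes I: "open I" "is_interval I" "s0 \<in> I" and A: "continuous_on I A"
    and X: "\<And>t. t \<in> I \<Longrightarrow> (X has_vector_derivative A t ** X t) (at t)"
    and Y: "\<And>t. t \<in> I \<Longrightarrow> (Y has_vector_derivative A t ** Y t) (at t)"
    and init: "X s0 = Y s0" and t: "t \<in> I"
  shows "X t = Y t"
proof -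
  have "X t - Y t = 0"
  proof (rule linear_ode_zero_unique[OF I])
    show "((\<lambda>t. X t - Y t) has_vector_derivative A t ** (X t - Y t)) (at t)" if "t \<in> I" for t
      using has_vector_derivative_diff[OF X[OF that] Y[OF that]]
      by (simp add: bounded_bilinear.diff_right[OF bounded_bilinear_matrix_mult])
    show "\<exists>K. \<forall>t\<in>{a..b}. norm (A t ** (X t - Y t)) \<le> K * norm (X t - Y t)" if "{a..b} \<subseteq> I" for a b
      using bounded_bilinear_compact_bound[OF bounded_bilinear_matrix_mult compact_Icc
          continuous_on_subset[OF A that]] by metis
  qed (use init t in simp_all)
  then show ?thesis
    by simp
qed

lemma continuous_on_frame_matrix:
  assumes "continuous_on S \<theta>" "continuous_on S \<theta>'" "continuous_on S \<mu>"
  shows "continuous_on S (\<lambda>s. frame_matrix (\<theta> s) (\<theta>' s) (\<mu> s))"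
proof -
  have "\<forall>i j. continuous_on S (\<lambda>s. frame_matrix (\<theta> s) (\<theta>' s) (\<mu> s) $ i $ j)"
    unfolding forall_3 frame_matrix_def by (simp add: assms continuous_intros)
  then show ?thesis
    by (intro continuous_on_vecI) blast
qed

text \<open>
  For a solution \<open>X\<close> of \<open>X' = A X\<close>, the Gram matrix of the rows satisfies the linear equation
  \<open>G' = A G + G A\<^sup>T\<close>. So does \<^term>\<open>gram_matrix (\<theta> s)\<close>, by the choice of the entries of \<open>A\<close>; the
  difference therefore vanishes everywhere if it vanishes at \<open>s0\<close>.
\<close>
lemma frame_ode_preserves_gram:
  assumes I: "open I" "is_interval I" "s0 \<in> I" and "smooth_on I \<theta>" "smooth_on I \<mu>"
    and X: "\<And>s. s \<in> I \<Longrightarrow>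
      (X has_vector_derivative frame_matrix (\<theta> s) (vderiv \<theta> s) (\<mu> s) ** X s) (at s)"
    and init: "X s0 ** Zmat ** transpose (X s0) = gram_matrix (\<theta> s0)" and s: "s \<in> I"
  shows "X s ** Zmat ** transpose (X s) = gram_matrix (\<theta> s)"
proof -
  define A where "A = (\<lambda>s. frame_matrix (\<theta> s) (vderiv \<theta> s) (\<mu> s))"
  define Y where "Y = (\<lambda>s. X s ** Zmat ** transpose (X s) - gram_matrix (\<theta> s))"
  let ?h = "\<lambda>P Q :: real^3^3. P ** Q + Q ** transpose P"
  have h: "bounded_bilinear ?h"
    unfolding bilinear_conv_bounded_bilinear[symmetric] bilinear_def linear_iff
    by (simp add: matrix_matrix_mult_def transpose_def vec_eq_iff sum.distrib sum_distrib_left algebra_simps)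
  have gram_bilinear: "bounded_bilinear (\<lambda>P Q :: real^3^3. P ** Zmat ** transpose Q)"
    unfolding bilinear_conv_bounded_bilinear[symmetric] bilinear_def linear_iff
    by (simp add: matrix_matrix_mult_def transpose_def vec_eq_iff sum.distrib sum_distrib_left algebra_simps)
  have cont: "continuous_on I A"
    unfolding A_def using assms(4,5)
    by (intro continuous_on_frame_matrix smooth_on_imp_continuous_on smooth_on_vderiv)
  have der_gram: "((\<lambda>s. gram_matrix (\<theta> s)) has_vector_derivative ?h (A s) (gram_matrix (\<theta> s))) (at s)"
    if s: "s \<in> I" for s
  proof -
    have "\<forall>i j. ((\<lambda>s. gram_matrix (\<theta> s) $ i $ j) has_vector_derivative
        ?h (A s) (gram_matrix (\<theta> s)) $ i $ j) (at s)"
      unfolding forall_3 gram_matrix_def A_def frame_matrix_def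
      using smooth_on_has_vector_derivative[OF assms(4) s]
      by (simp add: matrix_matrix_mult_def transpose_def sum_3)
    then show ?thesis
      by (intro has_vector_derivative_vecI) blast
  qed
  have der_Y: "(Y has_vector_derivative ?h (A s) (Y s)) (at s)" if "s \<in> I" for s
  proof -
    have "(Y has_vector_derivative
        X s ** Zmat ** transpose (A s ** X s) + A s ** X s ** Zmat ** transpose (X s) -
        ?h (A s) (gram_matrix (\<theta> s))) (at s)"
      unfolding Y_def A_def
      by (intro has_vector_derivative_diff der_gram[OF that, unfolded A_def]
          bounded_bilinear.has_vector_derivative[OF gram_bilinear] X that)
    also have "X s ** Zmat ** transpose (A s ** X s) + A s ** X s ** Zmat ** transpose (X s) =
        ?h (A s) (X s ** Zmat ** transpose (X s))"
      by (simp add: matrix_transpose_mul matrix_mul_assoc)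
    finally show ?thesis
      unfolding bounded_bilinear.diff_right[OF h, symmetric] Y_def .
  qed
  have "Y s = 0"
  proof (rule linear_ode_zero_unique[OF I _ der_Y _ s])
    show "\<exists>K. \<forall>t\<in>{a..b}. norm (?h (A t) (Y t)) \<le> K * norm (Y t)" if "{a..b} \<subseteq> I" for a b
      using bounded_bilinear_compact_bound[OF h compact_Icc continuous_on_subset[OF cont that]] by metis
  qed (simp_all add: Y_def init)
  then show ?thesis
    by (simp add: Y_def)
qed

text \<open>
  The Gram matrix leaves only \<open>1\<close> and \<open>- 1\<close> as values of the determinant, which is hence constant by
  continuity and has the value prescribed at \<open>s0\<close>.
\<close>
lemma pseudo_frame_exists:
  assumes I: "open I" "is_interval I" "s0 \<in> I" and smooth: "smooth_on I \<theta>" "smooth_on I \<mu>"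
    and "\<theta> s0 = 0" and \<epsilon>: "\<epsilon> \<in> {1, - 1}"
  obtains X where "pseudo_frame I \<theta> \<mu> \<epsilon> X"
proof -
  \<comment> \<open>the second and third rows span the two null lines orthogonal to the first, and \<open>\<epsilon>\<close> decides which is which\<close>
  define X0 :: "real^3^3" where
    "X0 = vector [vector [1, 0, 0], vector [0, 1, - \<epsilon>], vector [0, 1 / 2, \<epsilon> / 2]]"
  have \<epsilon>\<epsilon>: "\<epsilon> * \<epsilon> = 1"
    using \<epsilon> by auto
  have "continuous_on I (\<lambda>s. frame_matrix (\<theta> s) (vderiv \<theta> s) (\<mu> s))"
    using smooth by (intro continuous_on_frame_matrix smooth_on_imp_continuous_on smooth_on_vderiv)
  then obtain X where X0: "X s0 = X0" and X: "\<And>s. s \<in> I \<Longrightarrow>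
      (X has_vector_derivative frame_matrix (\<theta> s) (vderiv \<theta> s) (\<mu> s) ** X s) (at s)"
    using linear_ode_solution_exists[OF bounded_bilinear_matrix_mult I] by blast
  have "X s0 ** Zmat ** transpose (X s0) = gram_matrix (\<theta> s0)"
    unfolding gram_matrix_iff X0 \<open>\<theta> s0 = 0\<close> using \<epsilon>\<epsilon> by (simp add: X0_def lorentz_def)
  note gram = frame_ode_preserves_gram[OF I smooth X this]
  have "continuous_on I X"
    by (rule continuous_on_vector_derivative) (rule has_vector_derivative_at_within[OF X])
  then have cont: "continuous_on I (\<lambda>s. det (X s))"
    unfolding det_3 by (intro continuous_intros)
  have "(\<lambda>s. det (X s)) ` I \<subseteq> {1, - 1}"
    using gram_det_squared[OF gram] by (auto simp: power2_eq_1_iff)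
  then have "finite ((\<lambda>s. det (X s)) ` I)"
    by (rule finite_subset) simp
  then have "(\<lambda>s. det (X s)) constant_on I"
    using continuous_finite_range_constant[OF is_interval_connected[OF I(2)] cont] by blast
  moreover have "det (X s0) = \<epsilon>"
    unfolding X0 X0_def det_3 by simp
  ultimately have "det (X s) = \<epsilon>" if "s \<in> I" for s
    using that I(3) unfolding constant_on_def by auto
  then show ?thesis
    by (intro that[of X]) (simp add: pseudo_frame_def X gram)
qed

text \<open>
  By the frame equation the derivatives of the rows are combinations of the rows with smooth
  coefficients, so the rows gain one order of differentiability at a time.
\<close>
lemma pseudo_frame_smooth:
  assumes I: "open I" and smooth: "smooth_on I \<theta>" "smooth_on I \<mu>" and X: "pseudo_frame I \<theta> \<mu> \<epsilon> X"
  shows "smooth_on I (\<lambda>s. X s $ i)"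
proof -
  have "\<forall>i. differentiable_times k I (\<lambda>s. X s $ i)" for k
  proof (induction k)
    case (Suc k)
    have step: "differentiable_times (Suc k) I (\<lambda>s. X s $ i)"
      if "differentiable_times k I (\<lambda>s. (frame_matrix (\<theta> s) (vderiv \<theta> s) (\<mu> s) ** X s) $ i)" for i
      using I _ that
    proof (rule differentiable_times_SucI)
      show "((\<lambda>s. X s $ i) has_vector_derivative (frame_matrix (\<theta> s) (vderiv \<theta> s) (\<mu> s) ** X s) $ i) (at s)"
        if "s \<in> I" for s
        using X that unfolding pseudo_frame_def by (blast intro: has_vector_derivative_vec_nth)
    qed
    have coeff: "smooth_on I (\<lambda>s. - \<theta> s)" "smooth_on I (\<lambda>s. - \<mu> s)"
      "smooth_on I (\<lambda>s. vderiv \<theta> s / 2 + \<theta> s * \<mu> s)"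
      using smooth_on_diff[OF I smooth_on_const[of I 0] smooth(1)]
        smooth_on_diff[OF I smooth_on_const[of I 0] smooth(2)]
        smooth_on_add[OF I smooth_on_scaleR[OF I smooth_on_const[of I "1 / 2"] smooth_on_vderiv[OF smooth(1)]]
          smooth_on_bilinear[OF bounded_bilinear_mult I smooth]]
      by simp_all
    have product: "differentiable_times k I (\<lambda>s. f s *\<^sub>R X s $ i)" if "smooth_on I f" for f i
      using that Suc.IH unfolding smooth_on_iff
      by (intro differentiable_times_bilinear[OF bounded_bilinear_scaleR I]) blast+
    have "differentiable_times k I (\<lambda>s. X s $ 2)"
      using Suc.IH by blast
    moreover have "differentiable_times k I (\<lambda>s. - \<theta> s *\<^sub>R X s $ 1 - \<mu> s *\<^sub>R X s $ 2 +
        (vderiv \<theta> s / 2 + \<theta> s * \<mu> s) *\<^sub>R X s $ 3)"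
      using differentiable_times_add[OF I differentiable_times_add[OF I
          product[OF coeff(1), of 1] product[OF coeff(2), of 2]] product[OF coeff(3), of 3]]
      by simp
    moreover have "differentiable_times k I (\<lambda>s. - X s $ 1 + \<mu> s *\<^sub>R X s $ 3)"
      using differentiable_times_add[OF I product[OF smooth_on_const[of I "- 1"], of 1]
          product[OF smooth(2), of 3]]
      by simp
    ultimately show ?case
      unfolding forall_3 using step[of 1] step[of 2] step[of 3] by (simp only: frame_matrix_mult_rows simp_thms)
  qed simp
  then show ?thesis
    unfolding smooth_on_iff by blast
qed

text \<open>
  A frame determines a curve with the prescribed data: the first two rows become its tangent and
  curvature vectors by the frame equation, and the third row is its pseudo-binormal because of the
  orientation of the frame.
\<close>
lemma pseudo_frame_realizes:
  assumes I: "open I" "s0 \<in> I" and \<epsilon>: "\<epsilon> \<in> {1, - 1}" and smooth: "smooth_on I \<theta>" "smooth_on I \<mu>"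
    and zero: "\<forall>s\<in>I. \<theta> s = 0 \<longleftrightarrow> s = s0" and X: "pseudo_frame I \<theta> \<mu> \<epsilon> X"
    and \<gamma>: "\<And>s. s \<in> I \<Longrightarrow> (\<gamma> has_vector_derivative X s $ 1) (at s)"
  shows "realizes I s0 \<theta> \<mu> \<epsilon> \<gamma>"
proof -
  have der: "((\<lambda>t. X t $ i) has_vector_derivative
      (frame_matrix (\<theta> s) (vderiv \<theta> s) (\<mu> s) ** X s) $ i) (at s)" if "s \<in> I" for s i
    using X that unfolding pseudo_frame_def by (intro has_vector_derivative_vec_nth) blast
  have gram: "X s ** Zmat ** transpose (X s) = gram_matrix (\<theta> s)" and det: "det (X s) = \<epsilon>" if "s \<in> I" for s
    using X that unfolding pseudo_frame_def by blast+
  note g = gram[unfolded gram_matrix_iff]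
  have e: "vderiv \<gamma> s = X s $ 1" if "s \<in> I" for s
    using \<gamma>[OF that] by (rule vector_derivative_at)
  have k: "curvature_vector \<gamma> s = X s $ 2" if "s \<in> I" for s
    using has_vector_derivative_transform_within_open[OF der[OF that, of 1] I(1) that, of "vderiv \<gamma>"] e
    unfolding curvature_vector_def frame_matrix_mult_rows by (intro vector_derivative_at) auto
  have k': "vderiv (curvature_vector \<gamma>) s = (frame_matrix (\<theta> s) (vderiv \<theta> s) (\<mu> s) ** X s) $ 2"
    if "s \<in> I" for s
    using has_vector_derivative_transform_within_open[OF der[OF that, of 2] I(1) that, of "curvature_vector \<gamma>"] k
    by (intro vector_derivative_at) auto
  have unit: "unit_speed_spacelike_curve I \<gamma>"
    unfolding unit_speed_spacelike_curve_def spacelike_def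
  proof (intro conjI ballI)
    show "smooth_on I \<gamma>"
      by (rule smooth_onI_derivative[OF I(1) \<gamma> pseudo_frame_smooth[OF I(1) smooth X]])
    fix s assume s: "s \<in> I"
    show *: "lorentz (vderiv \<gamma> s) (vderiv \<gamma> s) = 1"
      using e[OF s] g[OF s] by simp
    then show "vderiv \<gamma> s \<noteq> 0" "0 < lorentz (vderiv \<gamma> s) (vderiv \<gamma> s) \<or> vderiv \<gamma> s = 0"
      by (auto simp: lorentz_linear)
  qed
  have nz: "curvature_vector \<gamma> s \<noteq> 0" if "s \<in> I" for s
    using k[OF that] g[OF that] by (auto simp: lorentz_linear)
  have causal: "causal_curvature \<gamma> s = \<theta> s" if "s \<in> I" for s
    using k[OF that] g[OF that] by (simp add: causal_curvature_def)
  have cross: "lorentz_cross (X s $ 1) (X s $ 2) = \<epsilon> *\<^sub>R (X s $ 2 - \<theta> s *\<^sub>R X s $ 3)" if "s \<in> I" for s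
    using frame_cross_iff[OF gram[OF that] \<epsilon>] det[OF that] by blast
  have sgn: "curve_sign \<gamma> s0 = \<epsilon>"
    using cross[OF I(2)] zero I(2) by (intro curve_sign_eqI \<epsilon> nz) (simp_all add: e k)
  have "is_pseudo_binormal I \<gamma> s0 (\<lambda>s. X s $ 3)"
    unfolding is_pseudo_binormal_def sgn
    using pseudo_frame_smooth[OF I(1) smooth X] cross e k causal by simp
  then have binormal: "pseudo_binormal I \<gamma> s0 s = X s $ 3" if "s \<in> I" for s
    using that by (rule pseudo_binormal_eqI[rotated 3]) (use I sgn \<epsilon> causal zero in auto)
  have "pseudo_torsion I \<gamma> s0 s = \<mu> s" if "s \<in> I" for s
    unfolding pseudo_torsion_def binormal[OF that] k'[OF that] frame_matrix_mult_rows
    using g[OF that] by (simp add: lorentz_linear)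
  then show ?thesis
    using unit nz causal sgn unfolding realizes_def nonzero_curvature_vector_def by blast
qed

text \<open>
  The frame equation multiplies from the left, so multiplying a solution from the right by a
  constant matrix gives another solution. The matrix \<open>B\<close> that carries one frame to the other at \<open>s0\<close>
  does so everywhere. As the two frames have the same Gram matrix and the same determinant, \<open>B\<close> preserves
  the form and the orientation.
\<close>
lemma pseudo_frames_congruent:
  assumes I: "open I" "is_interval I" "s0 \<in> I" and smooth: "smooth_on I \<theta>" "smooth_on I \<mu>"
    and \<epsilon>: "\<epsilon> \<noteq> 0" and X: "pseudo_frame I \<theta> \<mu> \<epsilon> X" and Y: "pseudo_frame I \<theta> \<mu> \<epsilon> Y"
  obtains B where "B ** Zmat ** transpose B = Zmat" "det B = 1" "\<And>s. s \<in> I \<Longrightarrow> Y s = X s ** B"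
proof -
  note pf = X[unfolded pseudo_frame_def] Y[unfolded pseudo_frame_def]
  have "det (X s0) \<noteq> 0"
    using pf(1) I(3) \<epsilon> by auto
  then obtain P where P: "X s0 ** P = mat 1" "P ** X s0 = mat 1"
    unfolding invertible_det_nz[symmetric] invertible_def by blast
  define B where "B = P ** Y s0"
  have XB: "X s0 ** B = Y s0"
    by (simp add: B_def matrix_mul_assoc P(1))
  have eq: "Y s = X s ** B" if "s \<in> I" for s
  proof (rule matrix_ode_unique[OF I _ _ _ _ that])
    show "continuous_on I (\<lambda>s. frame_matrix (\<theta> s) (vderiv \<theta> s) (\<mu> s))"
      using smooth by (intro continuous_on_frame_matrix smooth_on_imp_continuous_on smooth_on_vderiv)
    show "(Y has_vector_derivative frame_matrix (\<theta> t) (vderiv \<theta> t) (\<mu> t) ** Y t) (at t)" if "t \<in> I" for t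
      using pf(2) that by blast
    show "((\<lambda>t. X t ** B) has_vector_derivative frame_matrix (\<theta> t) (vderiv \<theta> t) (\<mu> t) ** (X t ** B)) (at t)"
      if "t \<in> I" for t
    proof -
      have "(X has_vector_derivative frame_matrix (\<theta> t) (vderiv \<theta> t) (\<mu> t) ** X t) (at t)"
        using pf(1) that by blast
      from bounded_bilinear.has_vector_derivative[OF bounded_bilinear_matrix_mult this has_vector_derivative_const[of B]]
      show ?thesis
        by (simp add: matrix_mul_assoc bounded_bilinear.zero_right[OF bounded_bilinear_matrix_mult])
    qed
  qed (simp add: XB)
  have "Y s0 ** Zmat ** transpose (Y s0) = X s0 ** Zmat ** transpose (X s0)"
    using pf I(3) by simp
  then have "P ** (X s0 ** B ** Zmat ** transpose (X s0 ** B)) ** transpose P =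
      P ** (X s0 ** Zmat ** transpose (X s0)) ** transpose P"
    by (simp add: XB)
  moreover have "P ** (X s0 ** Q ** transpose (X s0)) ** transpose P = Q" for Q :: "real^3^3"
  proof -
    have "P ** (X s0 ** Q ** transpose (X s0)) ** transpose P = (P ** X s0) ** Q ** transpose (P ** X s0)"
      by (simp only: matrix_mul_assoc matrix_transpose_mul)
    then show ?thesis
      by (simp add: P(2))
  qed
  from this[of "B ** Zmat ** transpose B"] this[of Zmat]
  have "P ** (X s0 ** B ** Zmat ** transpose (X s0 ** B)) ** transpose P = B ** Zmat ** transpose B"
    "P ** (X s0 ** Zmat ** transpose (X s0)) ** transpose P = Zmat"
    by (simp_all only: matrix_mul_assoc matrix_transpose_mul)
  ultimately have gram: "B ** Zmat ** transpose B = Zmat"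
    by simp
  have "det (X s0) * det B = det (Y s0)"
    by (simp add: det_mul flip: XB)
  then have "det B = 1"
    using pf I(3) \<epsilon> by simp
  with gram eq show ?thesis
    using that by blast
qed

text \<open>
  The linear part of the isometry is the transpose of \<open>B\<close>, since the vectors of the frame are rows. It
  carries one tangent field to the other, so the curves differ by a translation.
\<close>
lemma realized_curves_congruent:
  assumes I: "open I" "is_interval I" "s0 \<in> I" and \<epsilon>: "\<epsilon> \<in> {1, - 1}"
    and smooth: "smooth_on I \<theta>" "smooth_on I \<mu>" and zero: "\<forall>s\<in>I. \<theta> s = 0 \<longleftrightarrow> s = s0"
    and \<gamma>: "realizes I s0 \<theta> \<mu> \<epsilon> \<gamma>" and \<delta>: "realizes I s0 \<theta> \<mu> \<epsilon> \<delta>"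
  obtains T where "orientation_preserving_isometry T" "\<And>s. s \<in> I \<Longrightarrow> \<delta> s = T (\<gamma> s)"
proof -
  obtain X where X: "pseudo_frame I \<theta> \<mu> \<epsilon> X" "\<And>s. s \<in> I \<Longrightarrow> X s $ 1 = vderiv \<gamma> s"
    using realized_curve_has_frame[OF I(1,3) \<epsilon> smooth(1) zero \<gamma>] by blast
  obtain Y where Y: "pseudo_frame I \<theta> \<mu> \<epsilon> Y" "\<And>s. s \<in> I \<Longrightarrow> Y s $ 1 = vderiv \<delta> s"
    using realized_curve_has_frame[OF I(1,3) \<epsilon> smooth(1) zero \<delta>] by blast
  obtain B where B: "B ** Zmat ** transpose B = Zmat" "det B = 1" "\<And>s. s \<in> I \<Longrightarrow> Y s = X s ** B"
    by (rule pseudo_frames_congruent[OF I smooth _ X(1) Y(1)]) (use \<epsilon> in auto)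
  define A where "A = transpose B"
  define T where "T = (\<lambda>x. A *v x + (\<delta> s0 - A *v \<gamma> s0))"
  have row: "(P ** B) $ 1 = A *v (P $ 1)" for P :: "real^3^3"
    by (simp add: A_def vec_eq_iff matrix_matrix_mult_def matrix_vector_mult_def transpose_def mult.commute)
  have iso: "orientation_preserving_isometry T"
    unfolding orientation_preserving_isometry_def O21_def T_def
    using B(1,2) by (auto simp: A_def det_transpose intro!: exI[of _ "transpose B"])
  have "\<delta> s - T (\<gamma> s) = 0" if s: "s \<in> I" for s
  proof (rule linear_ode_zero_unique[OF I _ _ _ s, where Y'="\<lambda>_. 0"])
    show "((\<lambda>s. \<delta> s - T (\<gamma> s)) has_vector_derivative 0) (at t)" if t: "t \<in> I" for t
    proof -
      have \<gamma>': "(\<gamma> has_vector_derivative X t $ 1) (at t)" and \<delta>': "(\<delta> has_vector_derivative Y t $ 1) (at t)"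
        using \<gamma> \<delta> curve_derivatives(1)[OF _ t] unfolding X(2)[OF t] Y(2)[OF t] realizes_def by blast+
      have "((\<lambda>s. A *v \<gamma> s) has_vector_derivative A *v (X t $ 1)) (at t)"
        by (rule bounded_linear.has_vector_derivative[OF matrix_vector_mul_bounded_linear \<gamma>'])
      from has_vector_derivative_diff[OF \<delta>' has_vector_derivative_add[OF this has_vector_derivative_const]]
      show ?thesis
        by (simp add: T_def B(3)[OF t] row)
    qed
    show "\<exists>K. \<forall>t\<in>{a..b}. norm (0 :: real^3) \<le> K * norm (\<delta> t - T (\<gamma> t))" for a b
      by (rule exI[of _ 0]) simp
  qed (simp add: T_def)
  then show ?thesis
    by (intro that[OF iso]) simp
qed

theorem theorem3p5:
  fixes I :: "real set" and s0 :: real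
    and \<theta> \<mu> :: "real \<Rightarrow> real" and \<epsilon> :: real
  assumes "open I" and "is_interval I" and "s0 \<in> I"
    and "smooth_on I \<theta>" and "smooth_on I \<mu>"
    and "\<forall>s\<in>I. \<theta> s = 0 \<longleftrightarrow> s = s0"
    and "\<epsilon> \<in> {1, -1}"
  shows
    "(\<exists>\<gamma>. unit_speed_spacelike_curve I \<gamma> \<and> nonzero_curvature_vector I \<gamma> \<and>
        (\<forall>s\<in>I. causal_curvature \<gamma> s = \<theta> s) \<and>
        (\<forall>s\<in>I. pseudo_torsion I \<gamma> s0 s = \<mu> s) \<and>
        curve_sign \<gamma> s0 = \<epsilon>) \<and>
     (\<forall>\<gamma>1 \<gamma>2.
        unit_speed_spacelike_curve I \<gamma>1 \<and> nonzero_curvature_vector I \<gamma>1 \<and>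
        (\<forall>s\<in>I. causal_curvature \<gamma>1 s = \<theta> s) \<and>
        (\<forall>s\<in>I. pseudo_torsion I \<gamma>1 s0 s = \<mu> s) \<and>
        curve_sign \<gamma>1 s0 = \<epsilon> \<and>
        unit_speed_spacelike_curve I \<gamma>2 \<and> nonzero_curvature_vector I \<gamma>2 \<and>
        (\<forall>s\<in>I. causal_curvature \<gamma>2 s = \<theta> s) \<and>
        (\<forall>s\<in>I. pseudo_torsion I \<gamma>2 s0 s = \<mu> s) \<and>
        curve_sign \<gamma>2 s0 = \<epsilon> \<longrightarrow>
        (\<exists>T. orientation_preserving_isometry T \<and> (\<forall>s\<in>I. \<gamma>2 s = T (\<gamma>1 s))))"
proof
  obtain X where X: "pseudo_frame I \<theta> \<mu> \<epsilon> X"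
    using pseudo_frame_exists[OF assms(1-5) _ assms(7)] assms(3,6) by blast
  have "continuous_on I (\<lambda>s. X s $ 1)"
    by (rule smooth_on_imp_continuous_on[OF pseudo_frame_smooth[OF assms(1,4,5) X]])
  then obtain \<gamma> where "\<And>s. s \<in> I \<Longrightarrow> (\<gamma> has_vector_derivative X s $ 1) (at s)"
    using antiderivative_on_open_interval[OF assms(1-3)] by blast
  then have "realizes I s0 \<theta> \<mu> \<epsilon> \<gamma>"
    by (rule pseudo_frame_realizes[OF assms(1,3,7,4,5,6) X])
  then show "\<exists>\<gamma>. unit_speed_spacelike_curve I \<gamma> \<and> nonzero_curvature_vector I \<gamma> \<and>
        (\<forall>s\<in>I. causal_curvature \<gamma> s = \<theta> s) \<and>
        (\<forall>s\<in>I. pseudo_torsion I \<gamma> s0 s = \<mu> s) \<and>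
        curve_sign \<gamma> s0 = \<epsilon>"
    unfolding realizes_def by blast
next
  show "\<forall>\<gamma>1 \<gamma>2.
        unit_speed_spacelike_curve I \<gamma>1 \<and> nonzero_curvature_vector I \<gamma>1 \<and>
        (\<forall>s\<in>I. causal_curvature \<gamma>1 s = \<theta> s) \<and>
        (\<forall>s\<in>I. pseudo_torsion I \<gamma>1 s0 s = \<mu> s) \<and>
        curve_sign \<gamma>1 s0 = \<epsilon> \<and>
        unit_speed_spacelike_curve I \<gamma>2 \<and> nonzero_curvature_vector I \<gamma>2 \<and>
        (\<forall>s\<in>I. causal_curvature \<gamma>2 s = \<theta> s) \<and>
        (\<forall>s\<in>I. pseudo_torsion I \<gamma>2 s0 s = \<mu> s) \<and>
        curve_sign \<gamma>2 s0 = \<epsilon> \<longrightarrow>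
        (\<exists>T. orientation_preserving_isometry T \<and> (\<forall>s\<in>I. \<gamma>2 s = T (\<gamma>1 s)))"
  proof (intro allI impI, elim conjE)
    fix \<gamma>1 \<gamma>2
    assume "unit_speed_spacelike_curve I \<gamma>1" "nonzero_curvature_vector I \<gamma>1"
      "\<forall>s\<in>I. causal_curvature \<gamma>1 s = \<theta> s" "\<forall>s\<in>I. pseudo_torsion I \<gamma>1 s0 s = \<mu> s" "curve_sign \<gamma>1 s0 = \<epsilon>"
      "unit_speed_spacelike_curve I \<gamma>2" "nonzero_curvature_vector I \<gamma>2"
      "\<forall>s\<in>I. causal_curvature \<gamma>2 s = \<theta> s" "\<forall>s\<in>I. pseudo_torsion I \<gamma>2 s0 s = \<mu> s" "curve_sign \<gamma>2 s0 = \<epsilon>"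
    then have "realizes I s0 \<theta> \<mu> \<epsilon> \<gamma>1" "realizes I s0 \<theta> \<mu> \<epsilon> \<gamma>2"
      unfolding realizes_def by blast+
    then show "\<exists>T. orientation_preserving_isometry T \<and> (\<forall>s\<in>I. \<gamma>2 s = T (\<gamma>1 s))"
      using realized_curves_congruent[OF assms(1-3,7,4-6)] by metis
  qed
qed

end
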